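(* Let $M_n$, for $n\in\mathbb{N}$, be structures in a common countable first-order language, and let $M=\prod_n M_n/\mathrm{Fin}$. If the complete theory of $M$ is unstable, then $M$ is not $\aleph_2$-saturated. In particular, if the Continuum Hypothesis fails then $M$ is not saturated.
   Context: $\mathrm{Fin}$ is the ideal of finite subsets of $\mathbb{N}$. For an ideal $\mathcal I$ on a set $I$ and structures $M_i$ ($i\in I$) in the same language, the reduced product $\prod_i M_i/\mathcal I$ is the quotient of $\prod_i M_i$ by $(a_i)\sim(b_i)\iff\{i: a_i\neq b_i\}\in\mathcal I$, with function symbols interpreted coordinatewise modulo $\mathcal I$ and a relation $R$ holding of a tuple iff the set of coordinates where $R$ fails lies in $\mathcal I$. A type over $X\subseteq M$ is a consistent set of formulas in one free variable with parameters from $X$. $M$ is $\kappa$-saturated if every type over every $X\subseteq M$ with $|X|<\kappa$ is realised in $M$; saturated means $|M|$-saturated. A complete theory is stable if no formula $\varphi(\bar x,\bar y)$ has the order property (for every $k$ there exist $\bar a_i,\bar b_i$, $i<k$, in a model with $\varphi(\bar a_i,\bar b_j)$ iff $i\leq j$); otherwise it is unstable. *)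

theory Defs
  imports Main "HOL-Library.Countable_Set"
begin

unbundle cardinal_syntax

section \<open>First-order languages, structures and satisfaction\<close>

record ('f, 'r) language =
  fun_syms :: "'f set"
  rel_syms :: "'r set"
  fun_arity :: "'f \<Rightarrow> nat"
  rel_arity :: "'r \<Rightarrow> nat"

definition countable_language :: "('f, 'r) language \<Rightarrow> bool" where
  "countable_language L \<longleftrightarrow> countable (fun_syms L) \<and> countable (rel_syms L)"

datatype 'f tm = Var nat | App 'f "'f tm list"

datatype ('f, 'r) fm =
    Eq "'f tm" "'f tm"
  | Rel 'r "'f tm list"
  | Neg "('f, 'r) fm"
  | Conj "('f, 'r) fm" "('f, 'r) fm"
  | All nat "('f, 'r) fm"

primrec wf_tm :: "('f, 'r) language \<Rightarrow> 'f tm \<Rightarrow> bool" where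
  "wf_tm L (Var x) \<longleftrightarrow> True"
| "wf_tm L (App f ts) \<longleftrightarrow>
     f \<in> fun_syms L \<and> length ts = fun_arity L f \<and> list_all (wf_tm L) ts"

primrec wf_fm :: "('f, 'r) language \<Rightarrow> ('f, 'r) fm \<Rightarrow> bool" where
  "wf_fm L (Eq s t) \<longleftrightarrow> wf_tm L s \<and> wf_tm L t"
| "wf_fm L (Rel r ts) \<longleftrightarrow>
     r \<in> rel_syms L \<and> length ts = rel_arity L r \<and> list_all (wf_tm L) ts"
| "wf_fm L (Neg \<phi>) \<longleftrightarrow> wf_fm L \<phi>"
| "wf_fm L (Conj \<phi> \<psi>) \<longleftrightarrow> wf_fm L \<phi> \<and> wf_fm L \<psi>"
| "wf_fm L (All x \<phi>) \<longleftrightarrow> wf_fm L \<phi>"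

primrec fv_tm :: "'f tm \<Rightarrow> nat set" where
  "fv_tm (Var x) = {x}"
| "fv_tm (App f ts) = \<Union> (set (map fv_tm ts))"

primrec fv :: "('f, 'r) fm \<Rightarrow> nat set" where
  "fv (Eq s t) = fv_tm s \<union> fv_tm t"
| "fv (Rel r ts) = \<Union> (set (map fv_tm ts))"
| "fv (Neg \<phi>) = fv \<phi>"
| "fv (Conj \<phi> \<psi>) = fv \<phi> \<union> fv \<psi>"
| "fv (All x \<phi>) = fv \<phi> - {x}"

record ('a, 'f, 'r) struct =
  universe :: "'a set"
  fun_int :: "'f \<Rightarrow> 'a list \<Rightarrow> 'a"
  rel_int :: "'r \<Rightarrow> 'a list \<Rightarrow> bool"

text \<open>Interpretations are constrained only for symbols of \<open>L\<close> applied to argument lists of the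
  right length; other values are irrelevant to the well-formed formulas of \<open>L\<close>.\<close>

definition is_structure :: "('f, 'r) language \<Rightarrow> ('a, 'f, 'r) struct \<Rightarrow> bool" where
  "is_structure L M \<longleftrightarrow> universe M \<noteq> {} \<and>
     (\<forall>f \<in> fun_syms L. \<forall>as. length as = fun_arity L f \<longrightarrow> set as \<subseteq> universe M \<longrightarrow>
        fun_int M f as \<in> universe M)"

primrec tm_val :: "('a, 'f, 'r) struct \<Rightarrow> (nat \<Rightarrow> 'a) \<Rightarrow> 'f tm \<Rightarrow> 'a" where
  "tm_val M v (Var x) = v x"
| "tm_val M v (App f ts) = fun_int M f (map (tm_val M v) ts)"

primrec sat :: "('a, 'f, 'r) struct \<Rightarrow> (nat \<Rightarrow> 'a) \<Rightarrow> ('f, 'r) fm \<Rightarrow> bool" where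
  "sat M v (Eq s t) \<longleftrightarrow> tm_val M v s = tm_val M v t"
| "sat M v (Rel r ts) \<longleftrightarrow> rel_int M r (map (tm_val M v) ts)"
| "sat M v (Neg \<phi>) \<longleftrightarrow> \<not> sat M v \<phi>"
| "sat M v (Conj \<phi> \<psi>) \<longleftrightarrow> sat M v \<phi> \<and> sat M v \<psi>"
| "sat M v (All x \<phi>) \<longleftrightarrow> (\<forall>a \<in> universe M. sat M (v(x := a)) \<phi>)"

definition assignment :: "('a, 'f, 'r) struct \<Rightarrow> (nat \<Rightarrow> 'a) \<Rightarrow> bool" where
  "assignment M v \<longleftrightarrow> range v \<subseteq> universe M"

definition valid_in :: "('a, 'f, 'r) struct \<Rightarrow> ('f, 'r) fm \<Rightarrow> bool" where
  "valid_in M \<phi> \<longleftrightarrow> (\<forall>v. assignment M v \<longrightarrow> sat M v \<phi>)"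

definition complete_theory :: "('f, 'r) language \<Rightarrow> ('a, 'f, 'r) struct \<Rightarrow> ('f, 'r) fm set" where
  "complete_theory L M = {\<phi>. wf_fm L \<phi> \<and> fv \<phi> = {} \<and> valid_in M \<phi>}"

definition is_model :: "('f, 'r) language \<Rightarrow> ('f, 'r) fm set \<Rightarrow> ('a, 'f, 'r) struct \<Rightarrow> bool" where
  "is_model L T M \<longleftrightarrow> is_structure L M \<and> (\<forall>\<phi> \<in> T. valid_in M \<phi>)"


section \<open>Reduced products\<close>

definition is_ideal :: "'i set set \<Rightarrow> bool" where
  "is_ideal \<I> \<longleftrightarrow> {} \<in> \<I> \<and> (\<forall>A \<in> \<I>. \<forall>B. B \<subseteq> A \<longrightarrow> B \<in> \<I>) \<and> (\<forall>A \<in> \<I>. \<forall>B \<in> \<I>. A \<union> B \<in> \<I>)"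

definition Fin :: "nat set set" where
  "Fin = {A. finite A}"

definition product_set :: "('i \<Rightarrow> ('a, 'f, 'r) struct) \<Rightarrow> ('i \<Rightarrow> 'a) set" where
  "product_set M = {a. \<forall>i. a i \<in> universe (M i)}"

definition eq_mod :: "'i set set \<Rightarrow> ('i \<Rightarrow> ('a, 'f, 'r) struct) \<Rightarrow> (('i \<Rightarrow> 'a) \<times> ('i \<Rightarrow> 'a)) set" where
  "eq_mod \<I> M = {(a, b). a \<in> product_set M \<and> b \<in> product_set M \<and> {i. a i \<noteq> b i} \<in> \<I>}"

text \<open>The elements of the reduced product are equivalence classes. Both interpretations below
  quantify existentially over representatives \<open>as\<close> of the argument classes \<open>cs\<close>; independence of
  the choice is proved afterwards.\<close>

definition reduced_product ::
    "'i set set \<Rightarrow> ('i \<Rightarrow> ('a, 'f, 'r) struct) \<Rightarrow> (('i \<Rightarrow> 'a) set, 'f, 'r) struct" where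
  "reduced_product \<I> M =
     \<lparr> universe = product_set M // eq_mod \<I> M,
       fun_int = (\<lambda>f cs. {b \<in> product_set M. \<exists>as. list_all2 (\<in>) as cs \<and>
                    {i. b i \<noteq> fun_int (M i) f (map (\<lambda>a. a i) as)} \<in> \<I>}),
       rel_int = (\<lambda>r cs. \<exists>as. list_all2 (\<in>) as cs \<and>
                    {i. \<not> rel_int (M i) r (map (\<lambda>a. a i) as)} \<in> \<I>) \<rparr>"

lemma is_ideal_Fin: "is_ideal Fin"
  by (auto simp: is_ideal_def Fin_def intro: finite_subset)

lemma ideal_subset: "is_ideal \<I> \<Longrightarrow> A \<in> \<I> \<Longrightarrow> B \<subseteq> A \<Longrightarrow> B \<in> \<I>"
  by (auto simp: is_ideal_def)

lemma ideal_Un: "is_ideal \<I> \<Longrightarrow> A \<in> \<I> \<Longrightarrow> B \<in> \<I> \<Longrightarrow> A \<union> B \<in> \<I>"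
  by (auto simp: is_ideal_def)

lemma equiv_eq_mod:
  assumes "is_ideal \<I>"
  shows "equiv (product_set M) (eq_mod \<I> M)"
proof (rule equivI)
  show "eq_mod \<I> M \<subseteq> product_set M \<times> product_set M"
    by (auto simp: eq_mod_def)
  show "refl_on (product_set M) (eq_mod \<I> M)"
    using assms by (auto simp: refl_on_def eq_mod_def is_ideal_def)
  show "sym (eq_mod \<I> M)"
    by (auto simp: sym_def eq_mod_def eq_commute)
  show "trans (eq_mod \<I> M)"
  proof (rule transI)
    fix a b c assume ab: "(a, b) \<in> eq_mod \<I> M" and bc: "(b, c) \<in> eq_mod \<I> M"
    have "{i. a i \<noteq> b i} \<union> {i. b i \<noteq> c i} \<in> \<I>"
      using ab bc ideal_Un[OF assms] by (auto simp: eq_mod_def)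
    then have "{i. a i \<noteq> c i} \<in> \<I>"
      by (rule ideal_subset[OF assms]) auto
    then show "(a, c) \<in> eq_mod \<I> M"
      using ab bc by (auto simp: eq_mod_def)
  qed
qed

lemma representatives_agree:
  assumes "is_ideal \<I>" "list_all2 (\<lambda>a b. (a, b) \<in> eq_mod \<I> M) as bs"
  shows "{i. map (\<lambda>a. a i) as \<noteq> map (\<lambda>a. a i) bs} \<in> \<I>"
  using assms(2)
proof (induction rule: list_all2_induct)
  case Nil
  then show ?case using assms(1) by (simp add: is_ideal_def)
next
  case (Cons a as b bs)
  then have "{i. a i \<noteq> b i} \<union> {i. map (\<lambda>a. a i) as \<noteq> map (\<lambda>a. a i) bs} \<in> \<I>"
    using ideal_Un[OF assms(1)] by (auto simp: eq_mod_def)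
  then show ?case
    by (rule ideal_subset[OF assms(1)]) auto
qed

lemma reduced_product_rel_int:
  assumes "is_ideal \<I>" "set as \<subseteq> product_set M"
  shows "rel_int (reduced_product \<I> M) r (map (\<lambda>a. eq_mod \<I> M `` {a}) as) \<longleftrightarrow>
         {i. \<not> rel_int (M i) r (map (\<lambda>a. a i) as)} \<in> \<I>"
proof
  assume "{i. \<not> rel_int (M i) r (map (\<lambda>a. a i) as)} \<in> \<I>"
  moreover have "list_all2 (\<in>) as (map (\<lambda>a. eq_mod \<I> M `` {a}) as)"
    using assms(2) equiv_class_self[OF equiv_eq_mod[OF assms(1)]]
    by (auto simp: list_all2_conv_all_nth subset_iff intro: nth_mem)
  ultimately show "rel_int (reduced_product \<I> M) r (map (\<lambda>a. eq_mod \<I> M `` {a}) as)"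
    by (auto simp: reduced_product_def)
next
  assume "rel_int (reduced_product \<I> M) r (map (\<lambda>a. eq_mod \<I> M `` {a}) as)"
  then obtain bs where bs: "list_all2 (\<in>) bs (map (\<lambda>a. eq_mod \<I> M `` {a}) as)"
    and R: "{i. \<not> rel_int (M i) r (map (\<lambda>a. a i) bs)} \<in> \<I>"
    by (auto simp: reduced_product_def)
  have "list_all2 (\<lambda>a b. (a, b) \<in> eq_mod \<I> M) as bs"
    using bs by (auto simp: list_all2_conv_all_nth)
  then have "{i. map (\<lambda>a. a i) as \<noteq> map (\<lambda>a. a i) bs} \<union>
      {i. \<not> rel_int (M i) r (map (\<lambda>a. a i) bs)} \<in> \<I>"
    using representatives_agree[OF assms(1)] ideal_Un[OF assms(1)] R by blast
  then show "{i. \<not> rel_int (M i) r (map (\<lambda>a. a i) as)} \<in> \<I>"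
    by (rule ideal_subset[OF assms(1)]) (auto simp del: map_eq_conv)
qed

lemma reduced_product_fun_int:
  assumes "is_ideal \<I>" "set as \<subseteq> product_set M"
    and closed: "(\<lambda>i. fun_int (M i) f (map (\<lambda>a. a i) as)) \<in> product_set M"
  shows "fun_int (reduced_product \<I> M) f (map (\<lambda>a. eq_mod \<I> M `` {a}) as) =
         eq_mod \<I> M `` {\<lambda>i. fun_int (M i) f (map (\<lambda>a. a i) as)}" (is "?L = ?R")
proof (intro set_eqI iffI)
  fix b assume b: "b \<in> ?R"
  have "list_all2 (\<in>) as (map (\<lambda>a. eq_mod \<I> M `` {a}) as)"
    using assms(2) equiv_class_self[OF equiv_eq_mod[OF assms(1)]]
    by (auto simp: list_all2_conv_all_nth subset_iff intro: nth_mem)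
  moreover have "{i. b i \<noteq> fun_int (M i) f (map (\<lambda>a. a i) as)} \<in> \<I>" "b \<in> product_set M"
    using b by (auto simp: eq_mod_def eq_commute)
  ultimately show "b \<in> ?L"
    by (auto simp: reduced_product_def)
next
  fix b assume "b \<in> ?L"
  then obtain bs where bs: "list_all2 (\<in>) bs (map (\<lambda>a. eq_mod \<I> M `` {a}) as)"
    and b: "b \<in> product_set M" and R: "{i. b i \<noteq> fun_int (M i) f (map (\<lambda>a. a i) bs)} \<in> \<I>"
    by (auto simp: reduced_product_def)
  have "list_all2 (\<lambda>a b. (a, b) \<in> eq_mod \<I> M) as bs"
    using bs by (auto simp: list_all2_conv_all_nth)
  then have "{i. map (\<lambda>a. a i) as \<noteq> map (\<lambda>a. a i) bs} \<union>
      {i. b i \<noteq> fun_int (M i) f (map (\<lambda>a. a i) bs)} \<in> \<I>"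
    using representatives_agree[OF assms(1)] ideal_Un[OF assms(1)] R by blast
  then have "{i. fun_int (M i) f (map (\<lambda>a. a i) as) \<noteq> b i} \<in> \<I>"
    by (rule ideal_subset[OF assms(1)]) (auto simp del: map_eq_conv)
  then show "b \<in> ?R"
    using b closed by (auto simp: eq_mod_def)
qed

lemma is_structure_reduced_product:
  assumes I: "is_ideal \<I>" and M: "\<And>i. is_structure L (M i)"
  shows "is_structure L (reduced_product \<I> M)"
  unfolding is_structure_def
proof (intro conjI ballI allI impI)
  have "(\<lambda>i. SOME x. x \<in> universe (M i)) \<in> product_set M"
    using M by (auto simp: product_set_def is_structure_def some_in_eq)
  then show "universe (reduced_product \<I> M) \<noteq> {}"
    by (auto simp: reduced_product_def quotient_def)
next
  fix f cs assume f: "f \<in> fun_syms L" and len: "length cs = fun_arity L f"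
    and cs: "set cs \<subseteq> universe (reduced_product \<I> M)"
  have "\<forall>c \<in> set cs. \<exists>a. a \<in> product_set M \<and> c = eq_mod \<I> M `` {a}"
    using cs by (auto simp: reduced_product_def elim!: quotientE)
  then obtain g where g: "\<And>c. c \<in> set cs \<Longrightarrow> g c \<in> product_set M \<and> c = eq_mod \<I> M `` {g c}"
    by metis
  define as where "as = map g cs"
  have as: "set as \<subseteq> product_set M" and cs_eq: "cs = map (\<lambda>a. eq_mod \<I> M `` {a}) as"
    using g by (auto simp: as_def intro!: nth_equalityI)
  have cl: "(\<lambda>i. fun_int (M i) f (map (\<lambda>a. a i) as)) \<in> product_set M"
    unfolding product_set_def
  proof (intro CollectI allI)
    fix i
    have "length (map (\<lambda>a. a i) as) = fun_arity L f" "set (map (\<lambda>a. a i) as) \<subseteq> universe (M i)"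
      using as len by (auto simp: as_def product_set_def)
    then show "fun_int (M i) f (map (\<lambda>a. a i) as) \<in> universe (M i)"
      using M[of i] f unfolding is_structure_def by blast
  qed
  show "fun_int (reduced_product \<I> M) f cs \<in> universe (reduced_product \<I> M)"
    unfolding cs_eq reduced_product_fun_int[OF I as cl]
    using cl by (auto simp: reduced_product_def intro: quotientI)
qed


section \<open>Types and saturation\<close>

text \<open>Formulas with parameters from \<open>X\<close> are formulas of the language with a new constant symbol
  for every element of \<open>X\<close>, which is interpreted as that element.\<close>

definition lang_params :: "('f, 'r) language \<Rightarrow> 'a set \<Rightarrow> ('f + 'a, 'r) language" where
  "lang_params L X =
     \<lparr> fun_syms = Inl ` fun_syms L \<union> Inr ` X,
       rel_syms = rel_syms L,
       fun_arity = case_sum (fun_arity L) (\<lambda>_. 0),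
       rel_arity = rel_arity L \<rparr>"

definition struct_params :: "('a, 'f, 'r) struct \<Rightarrow> ('a, 'f + 'a, 'r) struct" where
  "struct_params M =
     \<lparr> universe = universe M,
       fun_int = case_sum (fun_int M) (\<lambda>a _. a),
       rel_int = rel_int M \<rparr>"

text \<open>The free variable is \<open>Var 0\<close>, so only the value of an assignment at \<open>0\<close> matters and the
  constant assignment \<open>\<lambda>_. a\<close> expresses satisfaction by \<open>a\<close>.\<close>

definition realises :: "('a, 'f, 'r) struct \<Rightarrow> 'a \<Rightarrow> ('f + 'a, 'r) fm set \<Rightarrow> bool" where
  "realises M a p \<longleftrightarrow> a \<in> universe M \<and> (\<forall>\<phi> \<in> p. sat (struct_params M) (\<lambda>_. a) \<phi>)"

text \<open>Consistency of a set of formulas over \<open>X\<close> refers to the theory of \<open>M\<close> with constants for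
  \<open>X\<close>; as that theory is complete, it means that every finite part is satisfied in \<open>M\<close>.\<close>

definition is_type_over ::
    "('f, 'r) language \<Rightarrow> ('a, 'f, 'r) struct \<Rightarrow> 'a set \<Rightarrow> ('f + 'a, 'r) fm set \<Rightarrow> bool" where
  "is_type_over L M X p \<longleftrightarrow>
     (\<forall>\<phi> \<in> p. wf_fm (lang_params L X) \<phi> \<and> fv \<phi> \<subseteq> {0}) \<and>
     (\<forall>q. finite q \<longrightarrow> q \<subseteq> p \<longrightarrow> (\<exists>a. realises M a q))"

definition kappa_saturated ::
    "'k rel \<Rightarrow> ('f, 'r) language \<Rightarrow> ('a, 'f, 'r) struct \<Rightarrow> bool" where
  "kappa_saturated \<kappa> L M \<longleftrightarrow>
     (\<forall>X p. X \<subseteq> universe M \<longrightarrow> |X| <o \<kappa> \<longrightarrow> is_type_over L M X p \<longrightarrow> (\<exists>a. realises M a p))"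

definition saturated :: "('f, 'r) language \<Rightarrow> ('a, 'f, 'r) struct \<Rightarrow> bool" where
  "saturated L M \<longleftrightarrow> kappa_saturated |universe M| L M"

definition aleph_1 :: "nat set rel" where
  "aleph_1 = cardSuc natLeq"

definition aleph_2 :: "nat set set rel" where
  "aleph_2 = cardSuc aleph_1"

definition continuum_hypothesis :: bool where
  "continuum_hypothesis \<longleftrightarrow> |UNIV :: nat set set| =o aleph_1"


section \<open>Stability\<close>

text \<open>The variables of \<open>\<phi>\<close> lying in \<open>V\<close> form the tuple \<open>x\<close> and its other free variables the tuple
  \<open>y\<close> of \<open>\<phi>(x, y)\<close>; the tuples \<open>a i\<close> and \<open>b j\<close> are given as assignments, of which only the values
  at the respective variables are used. The models range over the structures with elements in the
  type given by the first argument.\<close>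

definition has_order_property ::
    "'m itself \<Rightarrow> ('f, 'r) language \<Rightarrow> ('f, 'r) fm set \<Rightarrow> ('f, 'r) fm \<Rightarrow> nat set \<Rightarrow> bool" where
  "has_order_property (TM :: 'm itself) L T \<phi> V \<longleftrightarrow>
     (\<forall>k::nat. \<exists>(N :: ('m, 'f, 'r) struct) (a :: nat \<Rightarrow> nat \<Rightarrow> 'm) (b :: nat \<Rightarrow> nat \<Rightarrow> 'm).
        is_model L T N \<and>
        (\<forall>i<k. assignment N (a i) \<and> assignment N (b i)) \<and>
        (\<forall>i<k. \<forall>j<k. sat N (override_on (b j) (a i) V) \<phi> \<longleftrightarrow> i \<le> j))"

definition stable :: "'m itself \<Rightarrow> ('f, 'r) language \<Rightarrow> ('f, 'r) fm set \<Rightarrow> bool" where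
  "stable (TM :: 'm itself) L T \<longleftrightarrow>
     \<not> (\<exists>\<phi> V. wf_fm L \<phi> \<and> has_order_property TM L T \<phi> V)"

end

theory Submission
  imports Defs "HOL-Library.Countable_Set_Type" "HOL-Library.Ramsey"
begin

text \<open>Call a formula an h-formula (Palyutin) if the reduced product satisfies it exactly when almost
  all factors do. These formulas include the atomic ones and are closed under \<open>\<and>\<close>, \<open>\<exists>x. \<chi>\<close> and
  \<open>\<exists>x. \<chi> \<and> (\<forall>x. \<chi> \<longrightarrow> \<theta>)\<close>, and since the algebra of subsets modulo \<open>Fin\<close> is atomless, every
  formula is in \<open>M\<close> a Boolean combination of them. By Ramsey's theorem instability is therefore
  witnessed by an h-formula \<open>\<psi>\<close> with \<open>\<psi>(a0, b0)\<close>, \<open>\<psi>(a0, b1)\<close>, \<open>\<psi>(a1, b1)\<close> and \<open>\<not> \<psi>(a1, b0)\<close>.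

  On the infinite set of coordinates where \<open>\<psi>(a1, b0)\<close> fails, let \<open>a X\<close> be \<open>a1\<close> on \<open>X\<close> and \<open>a0\<close>
  elsewhere, and likewise \<open>b Y\<close>. Take Luzin's families \<open>\<F>\<close> and \<open>\<H>\<close> of \<open>\<aleph>\<^sub>1\<close> sets, almost disjoint
  from each other, such that no set \<open>C\<close> almost contains all members of \<open>\<F>\<close> and is almost disjoint
  from all members of \<open>\<H>\<close>. The conditions \<open>\<psi>(a F, y)\<close> for \<open>F \<in> \<F>\<close> and
  \<open>\<forall>x. \<psi>(x, y) \<and> \<psi>(x, b H) \<longrightarrow> \<psi>(x, b0)\<close> for \<open>H \<in> \<H>\<close> are finitely satisfied by \<open>b Y\<close> with \<open>Y\<close> a
  finite union of members of \<open>\<F>\<close>, but for a realisation \<open>y\<close> the set of coordinates at which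
  \<open>\<psi>(a1, y)\<close> holds would separate \<open>\<F>\<close> from \<open>\<H>\<close>.\<close>

section \<open>Syntax and satisfaction\<close>

lemma tm_val_cong:
  "(\<And>x. x \<in> fv_tm t \<Longrightarrow> v x = w x) \<Longrightarrow> tm_val N v t = tm_val N w t"
proof (induction t)
  case (App f ts)
  then have "map (tm_val N v) ts = map (tm_val N w) ts"
    by (auto intro!: map_cong)
  then show ?case by (simp del: map_eq_conv)
qed simp

lemma sat_cong:
  "(\<And>x. x \<in> fv \<phi> \<Longrightarrow> v x = w x) \<Longrightarrow> sat N v \<phi> \<longleftrightarrow> sat N w \<phi>"
proof (induction \<phi> arbitrary: v w)
  case (Eq s t)
  then show ?case using tm_val_cong[of s v w N] tm_val_cong[of t v w N] by simp
next
  case (Rel r ts)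
  then have "map (tm_val N v) ts = map (tm_val N w) ts"
    by (auto intro!: map_cong tm_val_cong)
  then show ?case by (simp del: map_eq_conv)
next
  case (Neg \<phi>)
  have "sat N v \<phi> \<longleftrightarrow> sat N w \<phi>" by (rule Neg.IH) (simp add: Neg.prems)
  then show ?case by simp
next
  case (Conj \<phi> \<psi>)
  have "sat N v \<phi> \<longleftrightarrow> sat N w \<phi>" by (rule Conj.IH) (simp add: Conj.prems)
  moreover have "sat N v \<psi> \<longleftrightarrow> sat N w \<psi>" by (rule Conj.IH) (simp add: Conj.prems)
  ultimately show ?case by simp
next
  case (All x \<phi>)
  have "sat N (v(x := a)) \<phi> \<longleftrightarrow> sat N (w(x := a)) \<phi>" for a
    by (rule All.IH) (simp add: All.prems)
  then show ?case by simp
qed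

lemma finite_fv_tm [simp]: "finite (fv_tm t)"
  by (induction t) auto

lemma finite_fv [simp]: "finite (fv \<phi>)"
  by (induction \<phi>) auto

section \<open>Derived connectives: existential quantifiers, finite conjunctions, quantifier
  blocks\<close>

definition Exi :: "nat \<Rightarrow> ('f, 'r) fm \<Rightarrow> ('f, 'r) fm" where
  "Exi x \<phi> = Neg (All x (Neg \<phi>))"

lemma sat_Exi [simp]: "sat N v (Exi x \<phi>) \<longleftrightarrow> (\<exists>a \<in> universe N. sat N (v(x := a)) \<phi>)"
  and wf_Exi [simp]: "wf_fm L (Exi x \<phi>) = wf_fm L \<phi>"
  and fv_Exi [simp]: "fv (Exi x \<phi>) = fv \<phi> - {x}"
  by (auto simp: Exi_def)

definition verum :: "('f, 'r) fm" where
  "verum = All 0 (Eq (Var 0) (Var 0))"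

lemma sat_verum [simp]: "sat N v verum"
  and wf_verum [simp]: "wf_fm L verum"
  and fv_verum [simp]: "fv verum = {}"
  by (auto simp: verum_def)

definition conjs :: "('f, 'r) fm list \<Rightarrow> ('f, 'r) fm" where
  "conjs \<phi>s = foldr Conj \<phi>s verum"

lemma sat_conjs [simp]: "sat N v (conjs \<phi>s) \<longleftrightarrow> (\<forall>\<phi> \<in> set \<phi>s. sat N v \<phi>)"
  and wf_conjs [simp]: "wf_fm L (conjs \<phi>s) \<longleftrightarrow> (\<forall>\<phi> \<in> set \<phi>s. wf_fm L \<phi>)"
  and fv_conjs [simp]: "fv (conjs \<phi>s) = (\<Union>\<phi> \<in> set \<phi>s. fv \<phi>)"
  by (induction \<phi>s) (auto simp: conjs_def)

definition exs :: "nat list \<Rightarrow> ('f, 'r) fm \<Rightarrow> ('f, 'r) fm" where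
  "exs xs \<phi> = foldr Exi xs \<phi>"

lemma wf_exs [simp]: "wf_fm L (exs xs \<phi>) = wf_fm L \<phi>"
  and fv_exs [simp]: "fv (exs xs \<phi>) = fv \<phi> - set xs"
  by (induction xs) (auto simp: exs_def)

lemma assignment_upd: "assignment N v \<Longrightarrow> a \<in> universe N \<Longrightarrow> assignment N (v(x := a))"
  by (auto simp: assignment_def)

lemma sat_exs:
  "assignment N v \<Longrightarrow> sat N v (exs xs \<phi>) \<longleftrightarrow>
     (\<exists>w. assignment N w \<and> (\<forall>x. x \<notin> set xs \<longrightarrow> w x = v x) \<and> sat N w \<phi>)"
proof (induction xs arbitrary: v)
  case Nil
  have "w = v" if "\<forall>x. w x = v x" for w using that by auto
  with Nil show ?case by (auto simp: exs_def)
next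
  case (Cons x xs)
  have "sat N v (exs (x # xs) \<phi>) \<longleftrightarrow> (\<exists>a \<in> universe N. sat N (v(x := a)) (exs xs \<phi>))"
    by (simp add: exs_def)
  also have "\<dots> \<longleftrightarrow> (\<exists>a \<in> universe N. \<exists>w. assignment N w \<and>
      (\<forall>y. y \<notin> set xs \<longrightarrow> w y = (v(x := a)) y) \<and> sat N w \<phi>)"
    by (intro bex_cong refl Cons.IH assignment_upd Cons.prems)
  also have "\<dots> \<longleftrightarrow> (\<exists>w. assignment N w \<and> (\<forall>y. y \<notin> set (x # xs) \<longrightarrow> w y = v y) \<and> sat N w \<phi>)"
    (is "?l \<longleftrightarrow> ?r")
  proof
    assume ?r
    then obtain w where w: "assignment N w" "\<forall>y. y \<notin> set (x # xs) \<longrightarrow> w y = v y" "sat N w \<phi>"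
      by blast
    then have "w x \<in> universe N" by (auto simp: assignment_def)
    with w show ?l by (intro bexI[of _ "w x"] exI[of _ w]) auto
  qed auto
  finally show ?case .
qed

section \<open>Renaming of variables\<close>

primrec rename_tm :: "(nat \<Rightarrow> nat) \<Rightarrow> 'f tm \<Rightarrow> 'f tm" where
  "rename_tm \<rho> (Var x) = Var (\<rho> x)"
| "rename_tm \<rho> (App f ts) = App f (map (rename_tm \<rho>) ts)"

text \<open>Bound variables are renamed too; for injective \<open>\<rho>\<close> no capture can occur.\<close>

primrec rename :: "(nat \<Rightarrow> nat) \<Rightarrow> ('f, 'r) fm \<Rightarrow> ('f, 'r) fm" where
  "rename \<rho> (Eq s t) = Eq (rename_tm \<rho> s) (rename_tm \<rho> t)"
| "rename \<rho> (Rel r ts) = Rel r (map (rename_tm \<rho>) ts)"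
| "rename \<rho> (Neg \<phi>) = Neg (rename \<rho> \<phi>)"
| "rename \<rho> (Conj \<phi> \<psi>) = Conj (rename \<rho> \<phi>) (rename \<rho> \<psi>)"
| "rename \<rho> (All x \<phi>) = All (\<rho> x) (rename \<rho> \<phi>)"

lemma tm_val_rename: "tm_val N v (rename_tm \<rho> t) = tm_val N (\<lambda>x. v (\<rho> x)) t"
proof (induction t)
  case (App f ts)
  then have "map (\<lambda>t. tm_val N v (rename_tm \<rho> t)) ts = map (tm_val N (\<lambda>x. v (\<rho> x))) ts"
    by (intro map_cong) auto
  then show ?case by (simp add: comp_def del: map_eq_conv)
qed simp

lemma sat_rename: "inj \<rho> \<Longrightarrow> sat N v (rename \<rho> \<phi>) \<longleftrightarrow> sat N (\<lambda>x. v (\<rho> x)) \<phi>"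
proof (induction \<phi> arbitrary: v)
  case (Rel r ts)
  show ?case by (simp add: tm_val_rename comp_def)
next
  case (All x \<phi>)
  have "(\<lambda>y. (v(\<rho> x := a)) (\<rho> y)) = (\<lambda>y. v (\<rho> y))(x := a)" for a
    using All.prems by (auto simp: fun_eq_iff inj_eq)
  with All show ?case by (simp del: fun_upd_apply)
qed (simp_all add: tm_val_rename)

lemma wf_rename_tm [simp]: "wf_tm L (rename_tm \<rho> t) = wf_tm L t"
  by (induction t) (auto simp: list_all_iff)

lemma wf_rename [simp]: "wf_fm L (rename \<rho> \<phi>) = wf_fm L \<phi>"
  by (induction \<phi>) (auto simp: list_all_iff)

lemma fv_rename_tm [simp]: "fv_tm (rename_tm \<rho> t) = \<rho> ` fv_tm t"
  by (induction t) auto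

lemma fv_rename: "inj \<rho> \<Longrightarrow> fv (rename \<rho> \<phi>) = \<rho> ` fv \<phi>"
  by (induction \<phi>) (auto simp: inj_eq)

section \<open>Passing the order property from models of a complete theory to the given
  structure\<close>

lemma sentence_transfer:
  assumes N: "is_model L (complete_theory L M) N" and \<sigma>: "wf_fm L \<sigma>" "fv \<sigma> = {}"
    and v: "assignment N v" "sat N v \<sigma>" and w: "assignment M w"
  shows "sat M w \<sigma>"
proof (rule ccontr)
  assume "\<not> sat M w \<sigma>"
  then have "sat M u (Neg \<sigma>)" for u
    using sat_cong[of \<sigma> u w M] \<sigma> by simp
  then have "Neg \<sigma> \<in> complete_theory L M"
    using \<sigma> by (simp add: complete_theory_def valid_in_def)
  then have "valid_in N (Neg \<sigma>)" using N by (auto simp: is_model_def)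
  with v show False by (simp add: valid_in_def)
qed

lemma assignment_exists:
  assumes "is_structure L M"
  shows "\<exists>v. assignment M v"
proof -
  obtain a where "a \<in> universe M" using assms by (auto simp: is_structure_def)
  then show ?thesis by (auto simp: assignment_def intro: exI[of _ "\<lambda>_. a"])
qed

text \<open>A single assignment has to carry all tuples of a half graph:
  \<open>prod_encode (x, i)\<close> stores entry \<open>x\<close> of the \<open>i\<close>-th left
  tuple if \<open>x\<close> is in \<open>V\<close>, and of the \<open>i\<close>-th right tuple
  otherwise.\<close>

definition copy_var :: "nat set \<Rightarrow> nat \<Rightarrow> nat \<Rightarrow> nat \<Rightarrow> nat" where
  "copy_var V i j x = prod_encode (x, if x \<in> V then i else j)"

lemma inj_copy_var: "inj (copy_var V i j)"
  by (auto simp: inj_def copy_var_def)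

definition half_graph :: "nat set \<Rightarrow> ('f, 'r) fm \<Rightarrow> nat \<Rightarrow> ('f, 'r) fm" where
  "half_graph V \<phi> k = conjs (map (\<lambda>(i, j). if i \<le> j then rename (copy_var V i j) \<phi>
      else Neg (rename (copy_var V i j) \<phi>)) (List.product [0..<k] [0..<k]))"

lemma sat_half_graph:
  "sat N v (half_graph V \<phi> k) \<longleftrightarrow>
     (\<forall>i<k. \<forall>j<k. sat N (\<lambda>x. v (copy_var V i j x)) \<phi> \<longleftrightarrow> i \<le> j)"
proof -
  have "sat N v (half_graph V \<phi> k) \<longleftrightarrow> (\<forall>(i, j) \<in> {..<k} \<times> {..<k}.
      sat N v (if i \<le> j then rename (copy_var V i j) \<phi> else Neg (rename (copy_var V i j) \<phi>)))"
    unfolding half_graph_def sat_conjs set_map ball_simps set_product set_upt atLeast0LessThan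
    by (simp add: split_beta)
  also have "\<dots> \<longleftrightarrow> (\<forall>(i, j) \<in> {..<k} \<times> {..<k}. sat N (\<lambda>x. v (copy_var V i j x)) \<phi> \<longleftrightarrow> i \<le> j)"
    by (intro ball_cong refl) (simp add: sat_rename[OF inj_copy_var] split_beta)
  finally show ?thesis by auto
qed

lemma wf_half_graph: "wf_fm L \<phi> \<Longrightarrow> wf_fm L (half_graph V \<phi> k)"
  by (auto simp: half_graph_def)

text \<open>For fixed \<open>k\<close> the existence of a half graph of length \<open>k\<close> is
  expressed by one sentence. It holds in some model of the complete theory of \<open>M\<close>,
  hence in \<open>M\<close>. The tuples depend on \<open>k\<close>, so no infinite half graph is
  obtained.\<close>

lemma order_property_transfer:
  fixes L :: "('f, 'r) language" and M :: "('d, 'f, 'r) struct"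
  assumes M: "is_structure L M" and \<phi>: "wf_fm L \<phi>"
    and op: "has_order_property TYPE('m) L (complete_theory L M) \<phi> V"
  shows "\<exists>a b. (\<forall>i. assignment M (a i)) \<and> (\<forall>j. assignment M (b j)) \<and>
    (\<forall>i<k. \<forall>j<k. sat M (override_on (b j) (a i) V) \<phi> \<longleftrightarrow> i \<le> (j::nat))"
proof -
  obtain N :: "('m, 'f, 'r) struct" and a b where N: "is_model L (complete_theory L M) N"
    and ab: "\<And>i. i < k \<Longrightarrow> assignment N (a i) \<and> assignment N (b i)"
    and sat: "\<And>i j. i < k \<Longrightarrow> j < k \<Longrightarrow> sat N (override_on (b j) (a i) V) \<phi> \<longleftrightarrow> i \<le> j"
    using op[unfolded has_order_property_def, rule_format, of k] by (elim exE conjE) blast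
  obtain v0 where v0: "assignment N v0"
    using N assignment_exists[of L N] by (auto simp: is_model_def)
  obtain u0 where u0: "assignment M u0" using assignment_exists[OF M] by auto
  define \<chi> where "\<chi> = half_graph V \<phi> k"
  define \<sigma> where "\<sigma> = exs (sorted_list_of_set (fv \<chi>)) \<chi>"
  have \<sigma>: "wf_fm L \<sigma>" "fv \<sigma> = {}"
    using \<phi> by (auto simp: \<sigma>_def \<chi>_def wf_half_graph)
  \<comment> \<open>Indices \<open>i \<ge> k\<close> take their values from \<open>v0\<close>, since
    \<open>a i\<close> and \<open>b i\<close> are known to lie in \<open>N\<close> only for
    \<open>i < k\<close>.\<close>
  define w where "w z = (let (x, i) = prod_decode z in
      if i < k then (if x \<in> V then a i x else b i x) else v0 x)" for z
  have "w z \<in> universe N" for z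
    using ab[of "snd (prod_decode z)"] v0
    by (auto simp: assignment_def w_def Let_def split_beta)
  then have w: "assignment N w" by (auto simp: assignment_def)
  have "(\<lambda>x. w (copy_var V i j x)) = override_on (b j) (a i) V" if "i < k" "j < k" for i j
    using that by (auto simp: fun_eq_iff w_def copy_var_def override_on_def)
  then have "sat N w \<chi>" using sat by (simp add: \<chi>_def sat_half_graph)
  then have "sat N w \<sigma>" unfolding \<sigma>_def sat_exs[OF w] using w by blast
  from sentence_transfer[OF N \<sigma> w this u0] have "sat M u0 \<sigma>" .
  then obtain u where u: "assignment M u" "sat M u \<chi>"
    unfolding \<sigma>_def sat_exs[OF u0] by blast
  have *: "override_on (\<lambda>x. u (prod_encode (x, j))) (\<lambda>x. u (prod_encode (x, i))) V =
      (\<lambda>x. u (copy_var V i j x))" for i j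
    by (auto simp: fun_eq_iff override_on_def copy_var_def)
  have "assignment M (\<lambda>x. u (prod_encode (x, i)))" for i
    using u(1) by (auto simp: assignment_def)
  with u(2) show ?thesis unfolding \<chi>_def sat_half_graph
    by (intro exI[of _ "\<lambda>i x. u (prod_encode (x, i))"]) (simp add: *)
qed

section \<open>Saturation for types of tuples\<close>

lemma universe_struct_params [simp]: "universe (struct_params M) = universe M"
  by (simp add: struct_params_def)

lemma assignment_struct_params [simp]: "assignment (struct_params M) v = assignment M v"
  by (simp add: assignment_def)

section \<open>Formulas of the language read in the expansion by constants\<close>

lemma tm_val_map_Inl: "tm_val (struct_params M) v (map_tm Inl t) = tm_val M v t"
proof (induction t)
  case (App f ts)
  then have "map (\<lambda>t. tm_val (struct_params M) v (map_tm Inl t)) ts = map (tm_val M v) ts"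
    by (intro map_cong) auto
  then show ?case by (simp add: comp_def struct_params_def del: map_eq_conv)
qed simp

lemma sat_map_Inl: "sat (struct_params M) v (map_fm Inl id \<phi>) \<longleftrightarrow> sat M v \<phi>"
proof (induction \<phi> arbitrary: v)
  case (Rel r ts)
  show ?case by (simp add: tm_val_map_Inl comp_def) (simp add: struct_params_def)
qed (simp_all add: tm_val_map_Inl)

lemma wf_map_tm_Inl: "wf_tm (lang_params L X) (map_tm Inl t) \<longleftrightarrow> wf_tm L t"
  by (induction t) (auto simp: lang_params_def list_all_iff)

lemma wf_map_Inl: "wf_fm (lang_params L X) (map_fm Inl id \<phi>) \<longleftrightarrow> wf_fm L \<phi>"
  by (induction \<phi>) (auto simp: wf_map_tm_Inl list_all_iff, auto simp: lang_params_def)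

lemma fv_map_tm [simp]: "fv_tm (map_tm g t) = fv_tm t"
  by (induction t) auto

lemma fv_map_fm [simp]: "fv (map_fm g h \<phi>) = fv \<phi>"
  by (induction \<phi>) auto


primrec inst_tm :: "(nat \<Rightarrow> 'a option) \<Rightarrow> ('f + 'a) tm \<Rightarrow> ('f + 'a) tm" where
  "inst_tm \<sigma> (Var x) = (case \<sigma> x of None \<Rightarrow> Var x | Some a \<Rightarrow> App (Inr a) [])"
| "inst_tm \<sigma> (App f ts) = App f (map (inst_tm \<sigma>) ts)"

text \<open>Under a quantifier the substitution forgets the bound variable. As only constants are
  inserted, nothing can be captured.\<close>

primrec inst :: "('f + 'a, 'r) fm \<Rightarrow> (nat \<Rightarrow> 'a option) \<Rightarrow> ('f + 'a, 'r) fm" where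
  "inst (Eq s t) \<sigma> = Eq (inst_tm \<sigma> s) (inst_tm \<sigma> t)"
| "inst (Rel r ts) \<sigma> = Rel r (map (inst_tm \<sigma>) ts)"
| "inst (Neg \<phi>) \<sigma> = Neg (inst \<phi> \<sigma>)"
| "inst (Conj \<phi> \<psi>) \<sigma> = Conj (inst \<phi> \<sigma>) (inst \<psi> \<sigma>)"
| "inst (All x \<phi>) \<sigma> = All x (inst \<phi> (\<sigma>(x := None)))"

definition override_opt :: "(nat \<Rightarrow> 'a) \<Rightarrow> (nat \<Rightarrow> 'a option) \<Rightarrow> nat \<Rightarrow> 'a" where
  "override_opt v \<sigma> x = (case \<sigma> x of None \<Rightarrow> v x | Some a \<Rightarrow> a)"

lemma tm_val_inst:
  "tm_val (struct_params M) v (inst_tm \<sigma> t) = tm_val (struct_params M) (override_opt v \<sigma>) t"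
proof (induction t)
  case (Var x)
  show ?case by (simp add: override_opt_def struct_params_def split: option.split)
next
  case (App f ts)
  then have "map (\<lambda>t. tm_val (struct_params M) v (inst_tm \<sigma> t)) ts =
      map (tm_val (struct_params M) (override_opt v \<sigma>)) ts"
    by (intro map_cong) auto
  then show ?case by (simp add: comp_def del: map_eq_conv)
qed

lemma sat_inst:
  "sat (struct_params M) v (inst \<phi> \<sigma>) \<longleftrightarrow> sat (struct_params M) (override_opt v \<sigma>) \<phi>"
proof (induction \<phi> arbitrary: v \<sigma>)
  case (Rel r ts)
  show ?case by (simp add: tm_val_inst comp_def)
next
  case (All x \<phi>)
  have "override_opt (v(x := a)) (\<sigma>(x := None)) = (override_opt v \<sigma>)(x := a)" for a
    by (auto simp: override_opt_def fun_eq_iff split: option.split)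
  then show ?case by (simp add: All.IH del: fun_upd_apply)
qed (simp_all add: tm_val_inst)

lemma wf_inst_tm:
  assumes "wf_tm (lang_params L X) t" "X \<subseteq> Y" "\<And>x a. \<sigma> x = Some a \<Longrightarrow> a \<in> Y"
  shows "wf_tm (lang_params L Y) (inst_tm \<sigma> t)"
  using assms by (induction t) (auto simp: lang_params_def list_all_iff split: option.split)

lemma wf_inst:
  assumes "wf_fm (lang_params L X) \<phi>" "X \<subseteq> Y" "\<And>x a. \<sigma> x = Some a \<Longrightarrow> a \<in> Y"
  shows "wf_fm (lang_params L Y) (inst \<phi> \<sigma>)"
  using assms
proof (induction \<phi> arbitrary: \<sigma>)
  case (Eq s t)
  then show ?case by (auto intro: wf_inst_tm)
next
  case (Rel r ts)
  then have "list_all (wf_tm (lang_params L Y)) (map (inst_tm \<sigma>) ts)"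
    by (auto simp: list_all_iff intro: wf_inst_tm)
  then show ?case using Rel.prems(1) by (auto simp: lang_params_def)
next
  case (All x \<phi>)
  have "wf_fm (lang_params L Y) (inst \<phi> (\<sigma>(x := None)))"
    using All.prems by (intro All.IH) (auto split: if_splits)
  then show ?case by simp
qed auto

lemma fv_inst_tm: "fv_tm (inst_tm \<sigma> t) = fv_tm t \<inter> {x. \<sigma> x = None}"
  by (induction t) (auto split: option.split)

lemma fv_inst: "fv (inst \<phi> \<sigma>) = fv \<phi> \<inter> {x. \<sigma> x = None}"
  by (induction \<phi> arbitrary: \<sigma>) (auto simp: fv_inst_tm)

text \<open>Saturation speaks about one variable, so tuples are realised entry by entry. The finite
  parts of \<Gamma>, with all variables but one quantified existentially, form a type; its
  realisation becomes a new parameter, and one free variable less remains. The infinite set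
  \<open>B\<close> bounds the number of parameters at every stage.\<close>

lemma kappa_saturated_tuple:
  fixes M :: "('a, 'f, 'r) struct" and B :: "'b set" and W :: "nat set"
  assumes sat: "kappa_saturated \<kappa> L M" and B: "infinite B" "|B| <o \<kappa>"
    and W: "finite W" and X: "X \<subseteq> universe M" "|X| \<le>o |B|"
    and \<Gamma>: "\<And>\<phi>. \<phi> \<in> \<Gamma> \<Longrightarrow> wf_fm (lang_params L X) \<phi> \<and> fv \<phi> \<subseteq> W"
    and fin: "\<And>q. finite q \<Longrightarrow> q \<subseteq> \<Gamma> \<Longrightarrow>
      \<exists>w. assignment M w \<and> (\<forall>\<phi> \<in> q. sat (struct_params M) w \<phi>)"
  shows "\<exists>w. assignment M w \<and> (\<forall>\<phi> \<in> \<Gamma>. sat (struct_params M) w \<phi>)"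
  using W X \<Gamma> fin
proof (induction W arbitrary: X \<Gamma> rule: finite_induct)
  case empty
  obtain w where w: "assignment M w" using empty.prems(4)[of "{}"] by auto
  have "sat (struct_params M) w \<phi>" if \<phi>: "\<phi> \<in> \<Gamma>" for \<phi>
  proof -
    obtain u where "sat (struct_params M) u \<phi>" using empty.prems(4)[of "{\<phi>}"] \<phi> by auto
    then show ?thesis using empty.prems(3)[OF \<phi>] sat_cong[of \<phi> u w] by auto
  qed
  with w show ?case by blast
next
  case (insert x W)
  \<comment> \<open>\<open>\<tau>\<close> exchanges \<open>x\<close> and \<open>0\<close>, since the
    free variable of a type is \<open>Var 0\<close>.\<close>
  define \<tau> :: "nat \<Rightarrow> nat" where "\<tau> y = (if y = 0 then x else if y = x then 0 else y)" for y
  have \<tau>: "inj \<tau>" "\<tau> x = 0" by (auto simp: inj_def \<tau>_def)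
  define ws where "ws = sorted_list_of_set W"
  have ws: "set ws = W" using insert.hyps by (simp add: ws_def)
  define E where "E l = rename \<tau> (exs ws (conjs l))" for l :: "('f + 'a, 'r) fm list"
  have sat_E: "sat (struct_params M) (\<lambda>_. c) (E l) \<longleftrightarrow>
      (\<exists>w. assignment M w \<and> (\<forall>y. y \<notin> W \<longrightarrow> w y = c) \<and> (\<forall>\<phi> \<in> set l. sat (struct_params M) w \<phi>))"
    if "c \<in> universe M" for c l
  proof -
    have "assignment (struct_params M) (\<lambda>_. c)" using that by (auto simp: assignment_def)
    then show ?thesis unfolding E_def sat_rename[OF \<tau>(1)] by (simp add: sat_exs ws)
  qed
  define p where "p = E ` {l. set l \<subseteq> \<Gamma>}"
  have "is_type_over L M X p"
    unfolding is_type_over_def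
  proof (intro conjI ballI allI impI)
    fix \<phi> assume "\<phi> \<in> p"
    then obtain l where l: "set l \<subseteq> \<Gamma>" "\<phi> = E l" by (auto simp: p_def)
    then show "wf_fm (lang_params L X) \<phi>" using insert.prems(3) by (auto simp: E_def)
    have "fv (exs ws (conjs l)) \<subseteq> {x}" using l insert.prems(3) by (fastforce simp: ws)
    then have "\<tau> ` fv (exs ws (conjs l)) \<subseteq> {0}" using \<tau>(2) by auto
    then show "fv \<phi> \<subseteq> {0}" by (simp only: l E_def fv_rename[OF \<tau>(1)])
  next
    fix q assume q: "finite q" "q \<subseteq> p"
    then obtain Q where Q: "finite Q" "Q \<subseteq> {l. set l \<subseteq> \<Gamma>}" "q = E ` Q"
      unfolding p_def by (meson finite_subset_image)
    define R where "R = (\<Union>l \<in> Q. set l)"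
    have "finite R" "R \<subseteq> \<Gamma>" using Q by (auto simp: R_def)
    from insert.prems(4)[OF this] obtain w where w: "assignment M w"
      "\<And>\<phi>. \<phi> \<in> R \<Longrightarrow> sat (struct_params M) w \<phi>" by blast
    have wx: "w x \<in> universe M" using w by (auto simp: assignment_def)
    have "sat (struct_params M) (\<lambda>_. w x) (E l)" if "l \<in> Q" for l
    proof -
      \<comment> \<open>\<open>realises\<close> evaluates at a constant assignment, so variables
        outside \<open>W\<close> must all take the value \<open>w x\<close>; apart from
        \<open>x\<close> itself they are not free in \<Gamma>.\<close>
      let ?u = "override_on (\<lambda>_. w x) w W"
      have "sat (struct_params M) ?u \<phi>" if \<phi>: "\<phi> \<in> set l" for \<phi>
      proof -
        have "\<phi> \<in> R" using \<phi> \<open>l \<in> Q\<close> by (auto simp: R_def)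
        then have "fv \<phi> \<subseteq> insert x W" "sat (struct_params M) w \<phi>"
          using insert.prems(3) \<open>R \<subseteq> \<Gamma>\<close> w by auto
        moreover have "?u y = w y" if "y \<in> insert x W" for y
          using that by (auto simp: override_on_def)
        ultimately show ?thesis using sat_cong[of \<phi> ?u w] by blast
      qed
      moreover have "assignment M ?u" using w(1) by (auto simp: assignment_def override_on_def)
      ultimately show ?thesis unfolding sat_E[OF wx] by (intro exI[of _ ?u]) auto
    qed
    then show "\<exists>a. realises M a q" using wx Q(3) by (auto simp: realises_def)
  qed
  moreover have "|X| <o \<kappa>" using insert.prems(2) B(2) by (rule ordLeq_ordLess_trans)
  ultimately obtain c where c: "realises M c p"
    using sat insert.prems(1) unfolding kappa_saturated_def by blast
  then have cM: "c \<in> universe M" by (simp add: realises_def)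
  define \<sigma> where "\<sigma> y = (if y = x then Some c else None)" for y
  define \<Delta> where "\<Delta> = (\<lambda>\<phi>. inst \<phi> \<sigma>) ` \<Gamma>"
  have "|{c}| \<le>o |B|" using B(1) by (intro card_of_singl_ordLeq) auto
  then have "|insert c X| \<le>o |B|"
    using insert.prems(2) B(1) card_of_Un_ordLeq_infinite_Field[of "|B|" "{c}" X]
      card_of_Card_order[of B] by (simp add: Field_card_of)
  moreover have "insert c X \<subseteq> universe M" using cM insert.prems(1) by simp
  moreover have "wf_fm (lang_params L (insert c X)) \<phi> \<and> fv \<phi> \<subseteq> W" if \<phi>: "\<phi> \<in> \<Delta>" for \<phi>
  proof -
    obtain \<psi> where \<psi>: "\<psi> \<in> \<Gamma>" "\<phi> = inst \<psi> \<sigma>" using \<phi> by (auto simp: \<Delta>_def)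
    have "wf_fm (lang_params L (insert c X)) \<phi>"
      using insert.prems(3)[OF \<psi>(1)] unfolding \<psi>(2)
      by (intro wf_inst[where X = X]) (auto simp: \<sigma>_def split: if_splits)
    moreover have "fv \<phi> \<subseteq> W"
      using insert.prems(3)[OF \<psi>(1)] unfolding \<psi>(2) fv_inst by (auto simp: \<sigma>_def)
    ultimately show ?thesis by simp
  qed
  moreover have "\<exists>w. assignment M w \<and> (\<forall>\<phi> \<in> q. sat (struct_params M) w \<phi>)"
    if q: "finite q" "q \<subseteq> \<Delta>" for q
  proof -
    obtain Q where Q: "finite Q" "Q \<subseteq> \<Gamma>" "q = (\<lambda>\<phi>. inst \<phi> \<sigma>) ` Q"
      using q unfolding \<Delta>_def by (meson finite_subset_image)
    then obtain l where l: "set l = Q" using finite_list by auto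
    then have "E l \<in> p" using Q by (auto simp: p_def)
    then have "sat (struct_params M) (\<lambda>_. c) (E l)" using c by (auto simp: realises_def)
    then obtain w where w: "assignment M w" "\<And>y. y \<notin> W \<Longrightarrow> w y = c"
      "\<And>\<phi>. \<phi> \<in> Q \<Longrightarrow> sat (struct_params M) w \<phi>"
      unfolding sat_E[OF cM] l by blast
    \<comment> \<open>As \<open>x\<close> is not in \<open>W\<close>, the witness already has
      \<open>w x = c\<close>.\<close>
    have "override_opt w \<sigma> = w"
      using w(2) insert.hyps by (auto simp: override_opt_def \<sigma>_def fun_eq_iff)
    then show ?thesis using w Q(3) by (auto simp: sat_inst)
  qed
  ultimately obtain w where w: "assignment M w" "\<And>\<phi>. \<phi> \<in> \<Delta> \<Longrightarrow> sat (struct_params M) w \<phi>"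
    using insert.IH[of "insert c X" \<Delta>] by blast
  have "assignment M (override_opt w \<sigma>)"
    using w(1) cM by (auto simp: assignment_def override_opt_def \<sigma>_def)
  moreover have "sat (struct_params M) (override_opt w \<sigma>) \<phi>" if "\<phi> \<in> \<Gamma>" for \<phi>
    using w(2)[of "inst \<phi> \<sigma>"] that by (simp add: \<Delta>_def sat_inst)
  ultimately show ?case by blast
qed

section \<open>Reduced products modulo \<open>Fin\<close>\<close>

text \<open>Every index is listed infinitely often in \<open>idx\<close>. A strictly increasing
  sequence takes its \<open>k\<close>-th point from \<open>A (idx k)\<close>, and each point taken
  is coloured by the index it was taken for.\<close>

lemma disjoint_infinite_choice:
  fixes A :: "'j \<Rightarrow> nat set"
  assumes J: "countable J" and A: "\<And>j. j \<in> J \<Longrightarrow> infinite (A j)"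
  shows "\<exists>g. \<forall>j \<in> J. infinite {n \<in> A j. g n = j}"
proof (cases "J = {}")
  case False
  define idx where "idx k = from_nat_into J (fst (prod_decode k))" for k
  have idx: "infinite (A (idx k))" for k
    using A False by (simp add: idx_def from_nat_into)
  have "\<exists>s. \<forall>k. s k \<in> A (idx k) \<and> s k < s (Suc k)"
  proof (rule dependent_nat_choice)
    show "\<exists>x. x \<in> A (idx 0)" using idx[of 0] by (metis ex_in_conv finite.emptyI)
    show "\<exists>y. y \<in> A (idx (Suc k)) \<and> x < y" for x k
      using idx[of "Suc k"] by (auto simp: infinite_nat_iff_unbounded)
  qed
  then obtain s where s: "\<And>k. s k \<in> A (idx k)" "\<And>k. s k < s (Suc k)" by blast
  then have inj: "inj s" by (intro strict_mono_imp_inj_on) (simp add: strict_mono_Suc_iff)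
  have "infinite {n \<in> A j. idx (inv s n) = j}" if j: "j \<in> J" for j
  proof -
    obtain m where m: "from_nat_into J m = j" using from_nat_into_surj[OF J j] by blast
    have "(\<lambda>i. s (prod_encode (m, i))) ` UNIV \<subseteq> {n \<in> A j. idx (inv s n) = j}"
    proof (clarify, intro conjI)
      fix i
      have "idx (prod_encode (m, i)) = j" using m by (simp add: idx_def)
      then show "s (prod_encode (m, i)) \<in> A j" "idx (inv s (s (prod_encode (m, i)))) = j"
        using s(1)[of "prod_encode (m, i)"] inj by simp_all
    qed
    moreover have "inj (\<lambda>i. s (prod_encode (m, i)))"
      using inj by (intro injI) (simp add: inj_eq)
    ultimately show ?thesis by (meson finite_subset range_inj_infinite)
  qed
  then show ?thesis by (intro exI[of _ "\<lambda>n. idx (inv s n)"] ballI)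
qed auto

locale fin_product =
  fixes L :: "('f, 'r) language" and Ms :: "nat \<Rightarrow> ('a, 'f, 'r) struct"
  assumes structures: "is_structure L (Ms n)"
begin

abbreviation M :: "((nat \<Rightarrow> 'a) set, 'f, 'r) struct" where
  "M \<equiv> reduced_product Fin Ms"

abbreviation cls :: "(nat \<Rightarrow> 'a) \<Rightarrow> (nat \<Rightarrow> 'a) set" where
  "cls p \<equiv> eq_mod Fin Ms `` {p}"

text \<open>Here \<open>w x n\<close> is the value of the variable \<open>x\<close> at coordinate
  \<open>n\<close>: the classes of the \<open>w x\<close> form an assignment in the reduced product,
  and \<open>proj w n\<close> is one in the \<open>n\<close>-th factor.\<close>

definition rep :: "(nat \<Rightarrow> nat \<Rightarrow> 'a) \<Rightarrow> bool" where
  "rep w \<longleftrightarrow> (\<forall>x. w x \<in> product_set Ms)"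

abbreviation (input) proj :: "(nat \<Rightarrow> nat \<Rightarrow> 'a) \<Rightarrow> nat \<Rightarrow> nat \<Rightarrow> 'a" where
  "proj w n \<equiv> \<lambda>x. w x n"

lemma universe_M: "universe M = cls ` product_set Ms"
  by (auto simp: reduced_product_def quotient_def)

lemma cls_eq_iff:
  assumes "p \<in> product_set Ms" "q \<in> product_set Ms"
  shows "cls p = cls q \<longleftrightarrow> (\<forall>\<^sub>\<infinity>n. p n = q n)"
proof -
  have "cls p = cls q \<longleftrightarrow> (p, q) \<in> eq_mod Fin Ms"
    using eq_equiv_class_iff[OF equiv_eq_mod[OF is_ideal_Fin]] assms by blast
  then show ?thesis
    using assms by (simp add: eq_mod_def Fin_def eventually_cofinite)
qed

lemma assignment_cls: "rep w \<Longrightarrow> assignment M (\<lambda>x. cls (w x))"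
  by (auto simp: assignment_def rep_def universe_M)

lemma assignment_rep:
  assumes "assignment M v"
  obtains w where "rep w" "v = (\<lambda>x. cls (w x))"
proof -
  have "\<forall>x. \<exists>p. p \<in> product_set Ms \<and> v x = cls p"
    using assms by (auto simp: assignment_def universe_M)
  then obtain w where "\<And>x. w x \<in> product_set Ms \<and> v x = cls (w x)" by metis
  then show thesis by (intro that[of w]) (auto simp: rep_def)
qed

lemma cls_upd: "(\<lambda>y. cls (w y))(x := cls p) = (\<lambda>y. cls ((w(x := p)) y))"
  by (rule ext) simp

lemma proj_upd: "proj (w(x := p)) n = (proj w n)(x := p n)"
  by (rule ext) simp

lemma rep_upd: "rep w \<Longrightarrow> p \<in> product_set Ms \<Longrightarrow> rep (w(x := p))"
  by (simp add: rep_def)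

lemma tm_val_product_set:
  assumes "rep w" "wf_tm L t"
  shows "tm_val (Ms n) (proj w n) t \<in> universe (Ms n)"
  using assms(2)
proof (induction t)
  case (Var x)
  then show ?case using assms(1) by (simp add: rep_def product_set_def)
next
  case (App f ts)
  then have "set (map (tm_val (Ms n) (proj w n)) ts) \<subseteq> universe (Ms n)"
    by (auto simp: list_all_iff)
  moreover have "f \<in> fun_syms L" "length ts = fun_arity L f" using App.prems by auto
  ultimately show ?case using structures[of n] unfolding is_structure_def by simp
qed

lemma tm_val_M:
  assumes w: "rep w" and "wf_tm L t"
  shows "tm_val M (\<lambda>x. cls (w x)) t = cls (\<lambda>n. tm_val (Ms n) (proj w n) t)"
  using assms(2)
proof (induction t)
  case (App f ts)
  let ?as = "map (\<lambda>t n. tm_val (Ms n) (proj w n) t) ts"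
  have wf: "\<And>t. t \<in> set ts \<Longrightarrow> wf_tm L t" using App.prems by (auto simp: list_all_iff)
  have eq: "map (tm_val M (\<lambda>x. cls (w x))) ts = map cls ?as"
    using App.IH wf by (auto simp: comp_def)
  have as: "set ?as \<subseteq> product_set Ms"
    using wf tm_val_product_set[OF w] by (auto simp: product_set_def)
  have closed: "(\<lambda>n. fun_int (Ms n) f (map (\<lambda>a. a n) ?as)) \<in> product_set Ms"
    using tm_val_product_set[OF w App.prems] by (simp add: product_set_def comp_def)
  show ?case
    using reduced_product_fun_int[OF is_ideal_Fin as closed]
    by (simp add: eq comp_def del: map_map) (simp add: comp_def)
qed simp

text \<open>A semantic version of Palyutin's h-formulas, which are defined syntactically.\<close>

definition horn :: "('f, 'r) fm \<Rightarrow> bool" where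
  "horn \<phi> \<longleftrightarrow> wf_fm L \<phi> \<and> (\<forall>w. rep w \<longrightarrow>
     (sat M (\<lambda>x. cls (w x)) \<phi> \<longleftrightarrow> (\<forall>\<^sub>\<infinity>n. sat (Ms n) (proj w n) \<phi>)))"

lemma horn_wf: "horn \<phi> \<Longrightarrow> wf_fm L \<phi>"
  by (simp add: horn_def)

lemma horn_sat: "horn \<phi> \<Longrightarrow> rep w \<Longrightarrow>
    sat M (\<lambda>x. cls (w x)) \<phi> \<longleftrightarrow> (\<forall>\<^sub>\<infinity>n. sat (Ms n) (proj w n) \<phi>)"
  by (simp add: horn_def)

lemma horn_sat_upd:
  assumes "horn \<phi>" "rep w" "p \<in> product_set Ms"
  shows "sat M ((\<lambda>y. cls (w y))(x := cls p)) \<phi> \<longleftrightarrow>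
    (\<forall>\<^sub>\<infinity>n. sat (Ms n) ((proj w n)(x := p n)) \<phi>)"
  using horn_sat[OF assms(1) rep_upd[OF assms(2,3)], of x] unfolding cls_upd proj_upd .

lemma horn_Eq:
  assumes wf: "wf_fm L (Eq s t)"
  shows "horn (Eq s t)"
  unfolding horn_def
proof (intro conjI allI impI wf)
  fix w assume w: "rep w"
  have "(\<lambda>n. tm_val (Ms n) (proj w n) s) \<in> product_set Ms"
    "(\<lambda>n. tm_val (Ms n) (proj w n) t) \<in> product_set Ms"
    using tm_val_product_set[OF w] wf by (auto simp: product_set_def)
  from cls_eq_iff[OF this]
  show "sat M (\<lambda>x. cls (w x)) (Eq s t) \<longleftrightarrow> (\<forall>\<^sub>\<infinity>n. sat (Ms n) (proj w n) (Eq s t))"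
    using wf tm_val_M[OF w] by simp
qed

lemma horn_Rel:
  assumes "wf_fm L (Rel r ts)"
  shows "horn (Rel r ts)"
  unfolding horn_def
proof (intro conjI allI impI assms)
  fix w assume w: "rep w"
  let ?as = "map (\<lambda>t n. tm_val (Ms n) (proj w n) t) ts"
  have wf: "\<And>t. t \<in> set ts \<Longrightarrow> wf_tm L t" using assms by (auto simp: list_all_iff)
  have eq: "map (tm_val M (\<lambda>x. cls (w x))) ts = map cls ?as"
    using wf by (auto simp: comp_def tm_val_M[OF w])
  have as: "set ?as \<subseteq> product_set Ms"
    using wf tm_val_product_set[OF w] by (auto simp: product_set_def)
  have "sat M (\<lambda>x. cls (w x)) (Rel r ts) \<longleftrightarrow> {n. \<not> rel_int (Ms n) r (map (\<lambda>a. a n) ?as)} \<in> Fin"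
    unfolding sat.simps eq by (rule reduced_product_rel_int[OF is_ideal_Fin as])
  then show "sat M (\<lambda>x. cls (w x)) (Rel r ts) \<longleftrightarrow> (\<forall>\<^sub>\<infinity>n. sat (Ms n) (proj w n) (Rel r ts))"
    by (simp only: Fin_def mem_Collect_eq eventually_cofinite sat.simps map_map comp_def)
qed

lemma horn_conjs: "(\<And>\<phi>. \<phi> \<in> set \<phi>s \<Longrightarrow> horn \<phi>) \<Longrightarrow> horn (conjs \<phi>s)"
  by (auto simp: horn_def eventually_ball_finite_distrib)

lemma factor_nonempty: "\<exists>a. a \<in> universe (Ms n)"
  using structures[of n] by (auto simp: is_structure_def)

text \<open>Choose a witness at every coordinate that has one and an arbitrary element elsewhere.
  This lets existential quantifiers pass through the quotient.\<close>

lemma eventually_choice: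
  "(\<exists>p \<in> product_set Ms. \<forall>\<^sub>\<infinity>n. P n (p n)) \<longleftrightarrow> (\<forall>\<^sub>\<infinity>n. \<exists>a \<in> universe (Ms n). P n a)"
proof
  assume *: "\<forall>\<^sub>\<infinity>n. \<exists>a \<in> universe (Ms n). P n a"
  have "\<forall>n. \<exists>a. a \<in> universe (Ms n) \<and> ((\<exists>b \<in> universe (Ms n). P n b) \<longrightarrow> P n a)"
    using factor_nonempty by blast
  then obtain p where "\<And>n. p n \<in> universe (Ms n) \<and> ((\<exists>b \<in> universe (Ms n). P n b) \<longrightarrow> P n (p n))"
    by metis
  moreover from this have "\<forall>\<^sub>\<infinity>n. P n (p n)" by (intro eventually_mono[OF *]) blast
  ultimately show "\<exists>p \<in> product_set Ms. \<forall>\<^sub>\<infinity>n. P n (p n)"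
    by (intro bexI[of _ p]) (auto simp: product_set_def)
qed (auto simp: product_set_def elim!: eventually_mono)

lemma horn_Exi:
  assumes "horn \<chi>"
  shows "horn (Exi x \<chi>)"
  unfolding horn_def
proof (intro conjI allI impI)
  fix w assume w: "rep w"
  show "sat M (\<lambda>y. cls (w y)) (Exi x \<chi>) \<longleftrightarrow> (\<forall>\<^sub>\<infinity>n. sat (Ms n) (proj w n) (Exi x \<chi>))"
    using horn_sat_upd[OF assms w] eventually_choice[of "\<lambda>n a. sat (Ms n) ((proj w n)(x := a)) \<chi>"]
    by (simp add: universe_M)
qed (use assms in \<open>simp add: horn_def\<close>)

definition guard :: "nat \<Rightarrow> ('f, 'r) fm \<Rightarrow> ('f, 'r) fm \<Rightarrow> ('f, 'r) fm" where
  "guard x \<chi> \<theta> = Conj (Exi x \<chi>) (All x (Neg (Conj \<chi> (Neg \<theta>))))"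

lemma sat_guard: "sat N v (guard x \<chi> \<theta>) \<longleftrightarrow> (\<exists>a \<in> universe N. sat N (v(x := a)) \<chi>) \<and>
    (\<forall>a \<in> universe N. sat N (v(x := a)) \<chi> \<longrightarrow> sat N (v(x := a)) \<theta>)"
  by (auto simp: guard_def)

text \<open>The existence clause in \<open>guard\<close> lets counterexamples to \<theta> on some of
  the coordinates be completed to an element satisfying \<chi> almost everywhere, so that the
  universal part can be tested coordinatewise.\<close>

lemma horn_guard:
  assumes \<chi>: "horn \<chi>" and \<theta>: "horn \<theta>"
  shows "horn (guard x \<chi> \<theta>)"
  unfolding horn_def
proof (intro conjI allI impI)
  show "wf_fm L (guard x \<chi> \<theta>)" using assms by (simp add: guard_def horn_def)
  fix w assume w: "rep w"
  let ?\<chi> = "\<lambda>n a. sat (Ms n) ((proj w n)(x := a)) \<chi>"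
  let ?\<theta> = "\<lambda>n a. sat (Ms n) ((proj w n)(x := a)) \<theta>"
  have sat_M: "sat M (\<lambda>y. cls (w y)) (guard x \<chi> \<theta>) \<longleftrightarrow> (\<forall>\<^sub>\<infinity>n. \<exists>a \<in> universe (Ms n). ?\<chi> n a) \<and>
      (\<forall>p \<in> product_set Ms. (\<forall>\<^sub>\<infinity>n. ?\<chi> n (p n)) \<longrightarrow> (\<forall>\<^sub>\<infinity>n. ?\<theta> n (p n)))"
    using horn_sat_upd[OF \<chi> w] horn_sat_upd[OF \<theta> w] eventually_choice[of ?\<chi>]
    by (simp add: sat_guard universe_M)
  show "sat M (\<lambda>y. cls (w y)) (guard x \<chi> \<theta>) \<longleftrightarrow> (\<forall>\<^sub>\<infinity>n. sat (Ms n) (proj w n) (guard x \<chi> \<theta>))"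
    unfolding sat_M unfolding sat_guard eventually_conj_iff
  proof (rule conj_cong[OF refl])
    assume ex: "\<forall>\<^sub>\<infinity>n. \<exists>a \<in> universe (Ms n). ?\<chi> n a"
    show "(\<forall>p \<in> product_set Ms. (\<forall>\<^sub>\<infinity>n. ?\<chi> n (p n)) \<longrightarrow> (\<forall>\<^sub>\<infinity>n. ?\<theta> n (p n))) \<longleftrightarrow>
        (\<forall>\<^sub>\<infinity>n. \<forall>a \<in> universe (Ms n). ?\<chi> n a \<longrightarrow> ?\<theta> n a)" (is "?l \<longleftrightarrow> ?r")
    proof
      assume ?r
      show ?l
      proof (intro ballI impI)
        fix p assume p: "p \<in> product_set Ms" and "\<forall>\<^sub>\<infinity>n. ?\<chi> n (p n)"
        from this(2) \<open>?r\<close> show "\<forall>\<^sub>\<infinity>n. ?\<theta> n (p n)"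
          by eventually_elim (use p in \<open>auto simp: product_set_def\<close>)
      qed
    next
      assume all: ?l
      \<comment> \<open>The element chosen is a counterexample to \<theta> wherever one exists. If
        it nevertheless satisfies \<theta> almost everywhere, only finitely many coordinates have
        counterexamples.\<close>
      let ?P = "\<lambda>n a. ?\<chi> n a \<and> (?\<theta> n a \<longrightarrow> (\<forall>b \<in> universe (Ms n). ?\<chi> n b \<longrightarrow> ?\<theta> n b))"
      have "\<forall>\<^sub>\<infinity>n. \<exists>a \<in> universe (Ms n). ?P n a"
        using ex by (rule eventually_mono) blast
      then obtain p where p: "p \<in> product_set Ms" "\<forall>\<^sub>\<infinity>n. ?P n (p n)"
        using eventually_choice[of ?P] by blast
      from p(2) have "\<forall>\<^sub>\<infinity>n. ?\<chi> n (p n)" by (rule eventually_mono) blast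
      then have "\<forall>\<^sub>\<infinity>n. ?\<theta> n (p n)" using all p(1) by blast
      with p(2) show ?r by eventually_elim blast
    qed
  qed
qed

text \<open>As the Boolean algebra of subsets modulo \<open>Fin\<close> has no atoms, failures of finitely many
  h-formulas can be placed on pairwise disjoint infinite sets of coordinates.\<close>

lemma simultaneous_witness:
  assumes w: "rep w" and \<chi>: "horn \<chi>" and H: "finite H" "\<And>\<theta>. \<theta> \<in> H \<Longrightarrow> horn \<theta>"
    and ex: "sat M (\<lambda>y. cls (w y)) (Exi x \<chi>)"
    and neg: "\<And>\<theta>. \<theta> \<in> H \<Longrightarrow> \<not> sat M (\<lambda>y. cls (w y)) (guard x \<chi> \<theta>)"
  shows "\<exists>a \<in> universe M. sat M ((\<lambda>y. cls (w y))(x := a)) \<chi> \<and>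
    (\<forall>\<theta> \<in> H. \<not> sat M ((\<lambda>y. cls (w y))(x := a)) \<theta>)"
proof -
  let ?S = "\<lambda>\<phi> n a. sat (Ms n) ((proj w n)(x := a)) \<phi>"
  define A where "A \<theta> = {n. \<exists>a \<in> universe (Ms n). ?S \<chi> n a \<and> \<not> ?S \<theta> n a}" for \<theta>
  have ex': "\<forall>\<^sub>\<infinity>n. \<exists>a \<in> universe (Ms n). ?S \<chi> n a"
    using ex horn_sat[OF horn_Exi[OF \<chi>] w] by simp
  have "infinite (A \<theta>)" if \<theta>: "\<theta> \<in> H" for \<theta>
  proof
    assume "finite (A \<theta>)"
    then have "\<forall>\<^sub>\<infinity>n. n \<notin> A \<theta>" by (simp add: eventually_cofinite)
    with ex' have "\<forall>\<^sub>\<infinity>n. sat (Ms n) (proj w n) (guard x \<chi> \<theta>)"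
      by eventually_elim (auto simp: sat_guard A_def)
    then show False using neg[OF \<theta>] horn_sat[OF horn_guard[OF \<chi> H(2)[OF \<theta>]] w] by simp
  qed
  then obtain g where g: "\<And>\<theta>. \<theta> \<in> H \<Longrightarrow> infinite {n \<in> A \<theta>. g n = \<theta>}"
    using disjoint_infinite_choice[of H A] H(1) countable_finite by blast
  \<comment> \<open>At a coordinate \<open>n\<close> only the formula \<open>g n\<close> has to be
    refuted, since an h-formula failing at infinitely many coordinates fails in
    \<open>M\<close>.\<close>
  let ?P = "\<lambda>n a. ?S \<chi> n a \<and> (n \<in> A (g n) \<longrightarrow> \<not> ?S (g n) n a)"
  have "\<forall>\<^sub>\<infinity>n. \<exists>a \<in> universe (Ms n). ?P n a"
    using ex' by (rule eventually_mono) (auto simp: A_def)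
  then obtain p where p: "p \<in> product_set Ms" "\<forall>\<^sub>\<infinity>n. ?P n (p n)"
    using eventually_choice[of ?P] by blast
  have "sat M ((\<lambda>y. cls (w y))(x := cls p)) \<chi>"
    unfolding horn_sat_upd[OF \<chi> w p(1)] using p(2) by (rule eventually_mono) blast
  moreover have "\<not> sat M ((\<lambda>y. cls (w y))(x := cls p)) \<theta>" if \<theta>: "\<theta> \<in> H" for \<theta>
  proof
    assume "sat M ((\<lambda>y. cls (w y))(x := cls p)) \<theta>"
    then have "\<forall>\<^sub>\<infinity>n. ?S \<theta> n (p n)" unfolding horn_sat_upd[OF H(2)[OF \<theta>] w p(1)] .
    with p(2) have "\<forall>\<^sub>\<infinity>n. \<not> (n \<in> A \<theta> \<and> g n = \<theta>)"
      by eventually_elim blast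
    then show False using g[OF \<theta>] by (simp add: eventually_cofinite)
  qed
  ultimately show ?thesis using p(1) by (auto simp: universe_M)
qed

text \<open>For finite \<open>H\<close> this is the semantic form of being equivalent in
  \<open>M\<close> to a Boolean combination of members of \<open>H\<close>.\<close>

definition determines :: "('f, 'r) fm set \<Rightarrow> ('f, 'r) fm \<Rightarrow> bool" where
  "determines H \<phi> \<longleftrightarrow> (\<forall>u v. assignment M u \<longrightarrow> assignment M v \<longrightarrow>
     (\<forall>h \<in> H. sat M u h \<longleftrightarrow> sat M v h) \<longrightarrow> (sat M u \<phi> \<longleftrightarrow> sat M v \<phi>))"

lemma determinesD:
  "determines H \<phi> \<Longrightarrow> assignment M u \<Longrightarrow> assignment M v \<Longrightarrow>
     (\<And>h. h \<in> H \<Longrightarrow> sat M u h \<longleftrightarrow> sat M v h) \<Longrightarrow> sat M u \<phi> \<longleftrightarrow> sat M v \<phi>"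
  unfolding determines_def by blast

text \<open>In the quantifier case, \<open>u\<close> has to reveal which
  \<open>T \<subseteq> H\<close> are exactly the sets of members of \<open>H\<close> satisfied by
  some \<open>u(x := a)\<close>. Such a \<open>T\<close> makes \<open>Exi x (c T)\<close> true and
  \<open>guard x (c T) \<theta>\<close> false for every \<theta> in \<open>H - T\<close>; the
  converse is \<open>simultaneous_witness\<close>.\<close>

lemma determined_by_horn:
  assumes "wf_fm L \<phi>"
  shows "\<exists>H. finite H \<and> (\<forall>h \<in> H. horn h) \<and> determines H \<phi>"
  using assms
proof (induction \<phi>)
  case (Eq s t)
  then show ?case using horn_Eq by (intro exI[of _ "{Eq s t}"]) (auto simp: determines_def)
next
  case (Rel r ts)
  then show ?case using horn_Rel by (intro exI[of _ "{Rel r ts}"]) (auto simp: determines_def)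
next
  case (Neg \<phi>)
  then show ?case by (simp add: determines_def)
next
  case (Conj \<phi> \<psi>)
  obtain H where H: "finite H" "\<forall>h \<in> H. horn h" "determines H \<phi>" using Conj by auto
  obtain K where K: "finite K" "\<forall>h \<in> K. horn h" "determines K \<psi>" using Conj by auto
  have "determines (H \<union> K) (Conj \<phi> \<psi>)"
    unfolding determines_def
  proof (intro allI impI)
    fix u v assume uv: "assignment M u" "assignment M v"
      and agree: "\<forall>h \<in> H \<union> K. sat M u h \<longleftrightarrow> sat M v h"
    have "sat M u \<phi> \<longleftrightarrow> sat M v \<phi>" by (rule determinesD[OF H(3) uv]) (use agree in blast)
    moreover have "sat M u \<psi> \<longleftrightarrow> sat M v \<psi>" by (rule determinesD[OF K(3) uv]) (use agree in blast)
    ultimately show "sat M u (Conj \<phi> \<psi>) \<longleftrightarrow> sat M v (Conj \<phi> \<psi>)" by simp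
  qed
  then show ?case using H K by (intro exI[of _ "H \<union> K"]) auto
next
  case (All x \<phi>)
  obtain H where H: "finite H" "\<forall>h \<in> H. horn h" "determines H \<phi>" using All by auto
  have "\<forall>T \<in> Pow H. \<exists>l. set l = T" using H(1) by (meson PowD finite_list finite_subset)
  then obtain lst where lst: "\<And>T. T \<subseteq> H \<Longrightarrow> set (lst T) = T" by (metis PowI)
  define c where "c T = conjs (lst T)" for T
  have c: "horn (c T)" if "T \<subseteq> H" for T
    unfolding c_def using that H(2) by (intro horn_conjs) (auto simp: lst)
  define K where "K = (\<lambda>T. Exi x (c T)) ` Pow H \<union> (\<lambda>(T, \<theta>). guard x (c T) \<theta>) ` (Pow H \<times> H)"
  have K: "finite K" "\<forall>h \<in> K. horn h"
    using H(1,2) c by (auto simp: K_def intro: horn_Exi horn_guard)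
  \<comment> \<open>One implication is enough, because agreement on \<open>K\<close> is symmetric in
    \<open>u\<close> and \<open>v\<close>.\<close>
  have dir: "sat M v (All x \<phi>)" if u: "assignment M u" and v: "assignment M v"
    and agree: "\<forall>h \<in> K. sat M u h \<longleftrightarrow> sat M v h" and sat_u: "sat M u (All x \<phi>)" for u v
  proof -
    have "sat M (v(x := b)) \<phi>" if b: "b \<in> universe M" for b
    proof -
      define T where "T = {h \<in> H. sat M (v(x := b)) h}"
      have T: "T \<subseteq> H" by (auto simp: T_def)
      have sat_c: "sat M (v(x := b)) (c T)" using T by (auto simp: c_def lst) (simp add: T_def)
      obtain w where w: "rep w" "u = (\<lambda>y. cls (w y))" using assignment_rep[OF u] .
      have "sat M v (Exi x (c T))" using sat_c b by auto
      moreover have "Exi x (c T) \<in> K" using T by (auto simp: K_def)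
      ultimately have 1: "sat M u (Exi x (c T))" using agree by blast
      have 2: "\<not> sat M u (guard x (c T) \<theta>)" if \<theta>: "\<theta> \<in> H - T" for \<theta>
      proof -
        have "\<not> sat M v (guard x (c T) \<theta>)" using \<theta> sat_c b by (auto simp: sat_guard T_def)
        moreover have "guard x (c T) \<theta> \<in> K" using T \<theta> by (force simp: K_def)
        ultimately show ?thesis using agree by blast
      qed
      obtain a where a: "a \<in> universe M" "sat M (u(x := a)) (c T)"
        "\<And>\<theta>. \<theta> \<in> H - T \<Longrightarrow> \<not> sat M (u(x := a)) \<theta>"
        using simultaneous_witness[OF w(1) c[OF T], of "H - T" x] 1 2 H(1,2) unfolding w(2) by blast
      have "sat M (u(x := a)) h \<longleftrightarrow> sat M (v(x := b)) h" if "h \<in> H" for h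
      proof (cases "h \<in> T")
        case True
        then show ?thesis using a(2) T by (auto simp: c_def lst) (simp add: T_def)
      next
        case False
        then show ?thesis using a(3) that by (auto simp: T_def)
      qed
      then have "sat M (u(x := a)) \<phi> \<longleftrightarrow> sat M (v(x := b)) \<phi>"
        by (intro determinesD[OF H(3)] assignment_upd u v a(1) b)
      then show ?thesis using sat_u a(1) by simp
    qed
    then show ?thesis by simp
  qed
  have "determines K (All x \<phi>)"
    unfolding determines_def
  proof (intro allI impI)
    fix u v assume uv: "assignment M u" "assignment M v" "\<forall>h \<in> K. sat M u h \<longleftrightarrow> sat M v h"
    then have "\<forall>h \<in> K. sat M v h \<longleftrightarrow> sat M u h" by blast
    with uv show "sat M u (All x \<phi>) \<longleftrightarrow> sat M v (All x \<phi>)" using dir by blast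
  qed
  then show ?case using K by blast
qed

end

section \<open>Luzin families\<close>

text \<open>A diagonal choice: \<open>k n \<ge> n\<close> lies in the \<open>n\<close>-th set of an
  enumeration but in none of the earlier ones. So the range of \<open>k\<close> meets the
  \<open>n\<close>-th set at most in \<open>k 0, ..., k n\<close>, and if that intersection lies
  below \<open>m\<close> then \<open>n < m\<close>.\<close>

lemma luzin_step:
  fixes S :: "'i \<Rightarrow> nat set"
  assumes I: "countable I" "infinite I" and S: "\<And>i. i \<in> I \<Longrightarrow> infinite (S i)"
    and ad: "\<And>i j. i \<in> I \<Longrightarrow> j \<in> I \<Longrightarrow> i \<noteq> j \<Longrightarrow> finite (S i \<inter> S j)"
  shows "\<exists>T. infinite T \<and> (\<forall>i \<in> I. finite (T \<inter> S i)) \<and> (\<forall>m. finite {i \<in> I. T \<inter> S i \<subseteq> {..<m}})"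
proof -
  define e where "e = from_nat_into I"
  have e: "inj e" "range e = I"
    using bij_betw_from_nat_into[OF I] by (auto simp: e_def bij_betw_def)
  have "\<exists>k\<ge>n. k \<in> S (e n) - (\<Union>i<n. S (e i))" for n
  proof -
    have "finite (S (e n) \<inter> S (e i))" if "i < n" for i
      using ad[of "e n" "e i"] e that by (auto simp: inj_eq)
    then have "finite (\<Union>i<n. S (e n) \<inter> S (e i))" by (intro finite_UN_I) auto
    moreover have "S (e n) = (S (e n) - (\<Union>i<n. S (e i))) \<union> (\<Union>i<n. S (e n) \<inter> S (e i))" by auto
    ultimately have "infinite (S (e n) - (\<Union>i<n. S (e i)))"
      using S[of "e n"] e by (metis finite_Un rangeI)
    then show ?thesis by (simp only: infinite_nat_iff_unbounded_le)
  qed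
  then obtain k where k: "\<And>n. n \<le> k n" "\<And>n. k n \<in> S (e n)" "\<And>n i. i < n \<Longrightarrow> k n \<notin> S (e i)"
    by (metis DiffE UN_I lessThan_iff)
  have "infinite (range k)"
    unfolding infinite_nat_iff_unbounded_le using k(1) by blast
  moreover have "finite (range k \<inter> S i)" if "i \<in> I" for i
  proof -
    obtain n where n: "i = e n" using \<open>i \<in> I\<close> e(2) by blast
    have "j \<le> n" if "k j \<in> S i" for j using k(3)[of n j] that n by (meson not_le)
    then have "range k \<inter> S i \<subseteq> k ` {..n}" by auto
    then show ?thesis by (rule finite_subset) simp
  qed
  moreover have "finite {i \<in> I. range k \<inter> S i \<subseteq> {..<m}}" for m
  proof (rule finite_subset)
    show "{i \<in> I. range k \<inter> S i \<subseteq> {..<m}} \<subseteq> e ` {..<m}"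
    proof
      fix i assume i: "i \<in> {i \<in> I. range k \<inter> S i \<subseteq> {..<m}}"
      then obtain n where n: "i = e n" using e(2) by blast
      then have "k n < m" using i k(2)[of n] by auto
      then show "i \<in> e ` {..<m}" using k(1)[of n] n by auto
    qed
  qed simp
  ultimately show ?thesis by blast
qed

text \<open>Recursion along \<open>R\<close>: the earlier sets are countably many and, by
  \<open>tot\<close>, pairwise almost disjoint, so \<open>luzin_step\<close> yields the next one.
  The last clause is Luzin's condition.\<close>

lemma luzin_family:
  fixes R :: "'b rel"
  assumes wf: "wf R" and cnt: "\<And>x. countable {y. (y, x) \<in> R}"
    and tot: "\<And>x y z. (y, x) \<in> R \<Longrightarrow> (z, x) \<in> R \<Longrightarrow> y \<noteq> z \<Longrightarrow> (y, z) \<in> R \<or> (z, y) \<in> R"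
  shows "\<exists>f :: 'b \<Rightarrow> nat set. \<forall>x. (\<forall>y. (y, x) \<in> R \<longrightarrow> finite (f x \<inter> f y)) \<and>
    (\<forall>m. finite {y. (y, x) \<in> R \<and> f x \<inter> f y \<subseteq> {..<m}})"
proof -
  \<comment> \<open>A partition into infinite sets, to which every new set is made almost disjoint: without it a
    finite initial segment of the family could cover almost all of the natural numbers.\<close>
  define D where "D n = (\<lambda>i. prod_encode (n, i)) ` UNIV" for n
  define P where "P f x T \<longleftrightarrow> infinite T \<and> (\<forall>n. finite (T \<inter> D n)) \<and>
    (\<forall>y. (y, x) \<in> R \<longrightarrow> finite (T \<inter> f y)) \<and> (\<forall>m. finite {y. (y, x) \<in> R \<and> T \<inter> f y \<subseteq> {..<m}})"
    for f :: "'b \<Rightarrow> nat set" and x T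
  have "\<exists>f. \<forall>x. P f x (f x)"
  proof (rule dependent_wf_choice[OF wf])
    show "P f x T = P g x T" if "\<And>z. (z, x) \<in> R \<Longrightarrow> f z = g z" for f g x T
    proof -
      have "{y. (y, x) \<in> R \<and> T \<inter> f y \<subseteq> {..<m}} = {y. (y, x) \<in> R \<and> T \<inter> g y \<subseteq> {..<m}}" for m
        using that by auto
      then show ?thesis using that by (simp add: P_def)
    qed
  next
    fix x f assume below: "\<And>y. (y, x) \<in> R \<Longrightarrow> P f y (f y)"
    define I :: "(nat + 'b) set" where "I = range Inl \<union> Inr ` {y. (y, x) \<in> R}"
    define S where "S = case_sum D f"
    have D: "infinite (D n)" for n
      unfolding D_def by (rule range_inj_infinite) (simp add: inj_def)
    have DD: "D n \<inter> D m = {}" if "n \<noteq> m" for n m using that by (auto simp: D_def)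
    have fD: "finite (f y \<inter> D n)" if "(y, x) \<in> R" for y n using below[OF that] by (simp add: P_def)
    have ff: "finite (f y \<inter> f z)" if "(y, x) \<in> R" "(z, x) \<in> R" "y \<noteq> z" for y z
      using tot[OF that] below[OF that(1)] below[OF that(2)] by (auto simp: P_def Int_commute)
    have "\<exists>T. infinite T \<and> (\<forall>i \<in> I. finite (T \<inter> S i)) \<and> (\<forall>m. finite {i \<in> I. T \<inter> S i \<subseteq> {..<m}})"
    proof (rule luzin_step)
      show "countable I" using cnt by (simp add: I_def)
      show "infinite I" by (simp add: I_def range_inj_infinite)
      show "infinite (S i)" if "i \<in> I" for i
        using that D below by (auto simp: I_def S_def P_def)
      show "finite (S i \<inter> S j)" if "i \<in> I" "j \<in> I" "i \<noteq> j" for i j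
        using that unfolding I_def
      proof (elim UnE imageE; clarsimp simp: S_def)
        show "finite (D n \<inter> D m)" if "n \<noteq> m" for n m using DD[OF that] by simp
        show "finite (D n \<inter> f y)" "finite (f y \<inter> D n)" if "(y, x) \<in> R" for n y
          using fD[OF that] by (simp_all add: Int_commute)
        show "finite (f y \<inter> f z)" if "y \<noteq> z" "(y, x) \<in> R" "(z, x) \<in> R" for y z
          using ff that by blast
      qed
    qed
    then obtain T where T: "infinite T" "\<And>i. i \<in> I \<Longrightarrow> finite (T \<inter> S i)"
      "\<And>m. finite {i \<in> I. T \<inter> S i \<subseteq> {..<m}}" by blast
    have "P f x T"
      unfolding P_def
    proof (intro conjI allI impI T(1))
      show "finite (T \<inter> D n)" for n using T(2)[of "Inl n"] by (simp add: I_def S_def)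
      show "finite (T \<inter> f y)" if "(y, x) \<in> R" for y
        using T(2)[of "Inr y"] that by (simp add: I_def S_def)
      show "finite {y. (y, x) \<in> R \<and> T \<inter> f y \<subseteq> {..<m}}" for m
      proof (rule finite_subset)
        show "{y. (y, x) \<in> R \<and> T \<inter> f y \<subseteq> {..<m}} \<subseteq> Inr -` {i \<in> I. T \<inter> S i \<subseteq> {..<m}}"
          by (auto simp: I_def S_def)
        show "finite (Inr -` {i \<in> I. T \<inter> S i \<subseteq> {..<m}})" by (rule finite_vimageI[OF T(3)]) simp
      qed
    qed
    then show "\<exists>T. P f x T" ..
  qed
  then show ?thesis unfolding P_def by blast
qed

section \<open>Countability and the cardinal \<open>aleph_1\<close>\<close>

lemma Card_order_aleph_1: "Card_order aleph_1"
  by (simp add: aleph_1_def cardSuc_Card_order natLeq_Card_order)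

lemma countable_iff_less_aleph_1: "countable A \<longleftrightarrow> |A| <o aleph_1"
proof -
  have "countable A \<longleftrightarrow> |A| \<le>o natLeq"
    by (simp add: countable_card_le_natLeq)
  then show ?thesis
    unfolding aleph_1_def using cardSuc_ordLeq_ordLess[OF natLeq_Card_order card_of_Card_order, of A] by blast
qed

lemma uncountable_Field_aleph_1: "uncountable (Field aleph_1)"
  using card_of_Field_ordIso[OF Card_order_aleph_1] countable_iff_less_aleph_1
  by (metis not_ordLess_ordIso)

lemma uncountable_UN_nat:
  assumes "uncountable S" "S \<subseteq> (\<Union>m::nat. B m)"
  shows "\<exists>m. uncountable (B m)"
proof (rule ccontr)
  assume "\<nexists>m. uncountable (B m)"
  then have "countable (\<Union>m. B m)" by (intro countable_UN) auto
  then show False using assms countable_subset by blast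
qed

text \<open>Split a Luzin family into two uncountable halves. If \<open>C\<close> separated them,
  uncountably many \<open>x\<close> in one half would have \<open>f x - C\<close> below one bound,
  and uncountably many \<open>y\<close> in the other \<open>f y \<inter> C\<close> below another;
  then all these \<open>f x \<inter> f y\<close> have a common bound. An \<open>x\<close> above
  infinitely many such \<open>y\<close> contradicts Luzin's condition.\<close>

lemma inseparable_families:
  "\<exists>\<F> \<H> :: nat set set. |\<F>| \<le>o aleph_1 \<and> |\<H>| \<le>o aleph_1 \<and>
    (\<forall>F \<in> \<F>. \<forall>H \<in> \<H>. finite (F \<inter> H)) \<and>
    \<not> (\<exists>C. (\<forall>F \<in> \<F>. finite (F - C)) \<and> (\<forall>H \<in> \<H>. finite (H \<inter> C)))"
proof -
  define r where "r = aleph_1"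
  define A where "A = Field r"
  have r: "Card_order r" by (simp add: r_def Card_order_aleph_1)
  then have wo: "Well_order r" by (rule card_order_on_well_order_on)
  have A: "uncountable A" using uncountable_Field_aleph_1 by (simp add: A_def r_def)
  define R where "R = r - Id"
  have wf: "wf R" using wo by (simp add: R_def well_order_on_def)
  have cnt: "countable {y. (y, x) \<in> R}" for x
  proof (cases "x \<in> A")
    case True
    have "{y. (y, x) \<in> R} = underS r x" by (auto simp: R_def underS_def)
    then show ?thesis
      using card_of_underS[OF r] True by (simp add: A_def countable_iff_less_aleph_1 r_def)
  next
    case False
    then have "{y. (y, x) \<in> R} = {}" by (auto simp: A_def R_def Field_def)
    then show ?thesis by simp
  qed
  have tot: "(y, z) \<in> R \<or> (z, y) \<in> R" if "y \<in> A" "z \<in> A" "y \<noteq> z" for y z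
    using wo that unfolding A_def R_def
    by (auto simp: well_order_on_def linear_order_on_def total_on_def)
  have RA: "(y, x) \<in> R \<Longrightarrow> y \<in> A" for x y by (auto simp: A_def R_def Field_def)
  obtain f :: "nat set \<Rightarrow> nat set" where
    ad: "\<And>x y. (y, x) \<in> R \<Longrightarrow> finite (f x \<inter> f y)" and
    luzin: "\<And>x m. finite {y. (y, x) \<in> R \<and> f x \<inter> f y \<subseteq> {..<m}}"
    using luzin_family[OF wf cnt] tot RA by meson
  \<comment> \<open>A bijection of \<open>A <+> A\<close> onto \<open>A\<close> supplies the two
    disjoint halves.\<close>
  have "|A <+> A| =o |A|"
    using A by (intro card_of_Plus_infinite1) (auto simp: countable_finite ordIso_imp_ordLeq card_of_refl)
  then obtain g where g: "bij_betw g (A <+> A) A" using card_of_ordIso by blast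
  define S T where "S = g ` Inl ` A" and "T = g ` Inr ` A"
  have inj: "inj_on g (A <+> A)" and im: "g ` (A <+> A) = A" using g by (auto simp: bij_betw_def)
  have S: "S \<subseteq> A" "uncountable S" and T: "T \<subseteq> A" "uncountable T"
    using im A inj by (auto simp: S_def T_def Plus_def countable_image_inj_eq inj_on_Un)
  have disj: "S \<inter> T = {}"
    using inj unfolding S_def T_def inj_on_def by auto
  have card: "|f ` B| \<le>o aleph_1" if "B \<subseteq> A" for B
    using that card_of_image[of f B] card_of_mono1[of B A] card_of_Field_ordIso[OF r]
    unfolding A_def r_def by (meson ordLeq_ordIso_trans ordLeq_transitive)
  have fin: "finite (F \<inter> H)" if FH: "F \<in> f ` S" "H \<in> f ` T" for F H
  proof -
    obtain x y where xy: "x \<in> S" "y \<in> T" "F = f x" "H = f y" using FH by auto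
    then have "(x, y) \<in> R \<or> (y, x) \<in> R" using tot S T disj by blast
    then show ?thesis using ad xy by (metis Int_commute)
  qed
  have nosep: False
    if C: "\<forall>F \<in> f ` S. finite (F - C)" "\<forall>H \<in> f ` T. finite (H \<inter> C)" for C
  proof -
    have "S \<subseteq> (\<Union>m. {x \<in> S. f x - C \<subseteq> {..<m}})"
      using C(1) finite_nat_bounded by fastforce
    from uncountable_UN_nat[OF S(2) this] obtain m where m: "uncountable {x \<in> S. f x - C \<subseteq> {..<m}}" by blast
    have "T \<subseteq> (\<Union>m. {x \<in> T. f x \<inter> C \<subseteq> {..<m}})"
      using C(2) finite_nat_bounded by fastforce
    from uncountable_UN_nat[OF T(2) this] obtain m' where m': "uncountable {x \<in> T. f x \<inter> C \<subseteq> {..<m'}}" by blast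
    have "infinite {x \<in> T. f x \<inter> C \<subseteq> {..<m'}}" using m' countable_finite by blast
    from infinite_countable_subset'[OF this] obtain Z where Z: "Z \<subseteq> {x \<in> T. f x \<inter> C \<subseteq> {..<m'}}" "countable Z" "infinite Z"
      by blast
    \<comment> \<open>Only countably many points lie in \<open>Z\<close> or below a member of it, so
      some \<open>x\<close> of the uncountable set lies above all of \<open>Z\<close>.\<close>
    have "countable (\<Union>z \<in> Z. insert z {y. (y, z) \<in> R})" using Z(2) cnt by auto
    then have "\<not> {x \<in> S. f x - C \<subseteq> {..<m}} \<subseteq> (\<Union>z \<in> Z. insert z {y. (y, z) \<in> R})"
      using m countable_subset by blast
    then obtain x where x: "x \<in> S" "f x - C \<subseteq> {..<m}" "\<And>z. z \<in> Z \<Longrightarrow> x \<noteq> z \<and> (x, z) \<notin> R"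
      by blast
    have "Z \<subseteq> {y. (y, x) \<in> R \<and> f x \<inter> f y \<subseteq> {..<max m m'}}"
    proof
      fix z assume z: "z \<in> Z"
      have "x \<in> A" "z \<in> A" using x(1) z S(1) T(1) Z(1) by auto
      then have "(z, x) \<in> R" using tot[of x z] x(3)[OF z] by auto
      moreover have "f x \<inter> f z \<subseteq> {..<max m m'}"
      proof
        fix k assume k: "k \<in> f x \<inter> f z"
        show "k \<in> {..<max m m'}"
        proof (cases "k \<in> C")
          case True
          then have "k < m'" using k z Z(1) by auto
          then show ?thesis by simp
        next
          case False
          then have "k < m" using k x(2) by auto
          then show ?thesis by simp
        qed
      qed
      ultimately show "z \<in> {y. (y, x) \<in> R \<and> f x \<inter> f y \<subseteq> {..<max m m'}}" by blast
    qed
    then show False using luzin[of x "max m m'"] Z(3) finite_subset by blast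
  qed
  show ?thesis
  proof (intro exI conjI ballI)
    show "|f ` S| \<le>o aleph_1" "|f ` T| \<le>o aleph_1" using card S(1) T(1) by auto
    show "finite (F \<inter> H)" if "F \<in> f ` S" "H \<in> f ` T" for F H using fin that .
    show "\<not> (\<exists>C. (\<forall>F \<in> f ` S. finite (F - C)) \<and> (\<forall>H \<in> f ` T. finite (H \<inter> C)))"
      by (rule notI, elim exE conjE, rule nosep)
  qed
qed

section \<open>A monochromatic quadruple\<close>

text \<open>The bound \<open>N\<close> is fixed before the colouring, because the half graphs at
  hand are finite and their length must be named before the tuples are given.\<close>

lemma ramsey_pairs:
  assumes K: "finite K"
  shows "\<exists>N::nat. \<forall>c. (\<forall>i j. c i j \<in> K) \<longrightarrow> (\<exists>i0 i1 i2 i3 k. i0 < i1 \<and> i1 < i2 \<and> i2 < i3 \<and> i3 < N \<and>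
    (\<forall>i \<in> {i0, i1, i2, i3}. \<forall>j \<in> {i0, i1, i2, i3}. i < j \<longrightarrow> c i j = k))"
proof -
  obtain h where h: "bij_betw h K {0..<card K}" using ex_bij_betw_finite_nat[OF K] by blast
  obtain N where N: "partn_lst {..<N::nat} (replicate (card K) 4) 2" using ramsey_full by blast
  have main: "\<exists>i0 i1 i2 i3 k. i0 < i1 \<and> i1 < i2 \<and> i2 < i3 \<and> i3 < N \<and>
      (\<forall>i \<in> {i0, i1, i2, i3}. \<forall>j \<in> {i0, i1, i2, i3}. i < j \<longrightarrow> c i j = k)"
    if c: "\<forall>i j. c i j \<in> K" for c
  proof -
    \<comment> \<open>\<open>Min\<close> and \<open>Max\<close> recover the order of the pair, as
      \<open>c\<close> need not be symmetric.\<close>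
    define f where "f e = h (c (Min e) (Max e))" for e
    have "f \<in> nsets {..<N} 2 \<rightarrow> {..<length (replicate (card K) (4::nat))}"
      using h c by (auto simp: f_def bij_betw_def)
    then obtain i where i: "i < card K" "monochromatic {..<N} 4 2 f i"
      using N unfolding partn_lst_def by (metis length_replicate nth_replicate)
    then obtain H where H: "H \<in> nsets {..<N} 4" "f ` nsets H 2 \<subseteq> {i}"
      unfolding monochromatic_def by blast
    obtain i0 i1 i2 i3 where o: "H = {i0, i1, i2, i3}" "i0 < i1" "i1 < i2" "i2 < i3" "i3 < N"
      using H(1) unfolding ordered_nsets_4_eq by auto
    have col: "h (c j k) = i" if "j \<in> H" "k \<in> H" "j < k" for j k
    proof -
      have "{j, k} \<in> nsets H 2" using that by auto
      then have "f {j, k} = i" using H(2) by blast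
      moreover have "Min {j, k} = j" "Max {j, k} = k" using \<open>j < k\<close> by auto
      ultimately show ?thesis by (simp add: f_def)
    qed
    have "c j k = c i0 i1" if "j \<in> H" "k \<in> H" "j < k" for j k
      using col[OF that] col[of i0 i1] o h c by (auto simp: bij_betw_def dest: inj_onD)
    then have "\<forall>j \<in> H. \<forall>k \<in> H. j < k \<longrightarrow> c j k = c i0 i1" by blast
    then show ?thesis
      unfolding o(1) using o(2-5)
      by (intro exI[of _ i0] exI[of _ i1] exI[of _ i2] exI[of _ i3] exI[of _ "c i0 i1"] conjI)
  qed
  show ?thesis by (rule exI[of _ N], intro allI impI, rule main)
qed

section \<open>Instability and the omitted type\<close>

text \<open>The formula \<open>\<forall>x. \<psi>(x, y) \<and> \<psi>(x, c) \<longrightarrow> \<psi>(x, d)\<close>, where \<open>x\<close> consists of the variables in \<open>V\<close>.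
  For \<open>d = b0\<close> it expresses that \<open>y\<close> and \<open>c\<close> are almost disjoint.\<close>

definition meet_fm :: "nat set \<Rightarrow> ('f, 'r) fm \<Rightarrow> (nat \<Rightarrow> 'a) \<Rightarrow> (nat \<Rightarrow> 'a) \<Rightarrow> ('f + 'a, 'r) fm" where
  "meet_fm V \<psi> c d = Neg (exs (sorted_list_of_set (fv \<psi> \<inter> V))
     (Conj (Conj (map_fm Inl id \<psi>) (inst (map_fm Inl id \<psi>) (\<lambda>x. if x \<in> V then None else Some (c x))))
       (Neg (inst (map_fm Inl id \<psi>) (\<lambda>x. if x \<in> V then None else Some (d x))))))"

lemma override_opt_outside:
  "override_opt v (\<lambda>x. if x \<in> V then None else Some (c x)) = override_on c v V"
  by (auto simp: fun_eq_iff override_opt_def override_on_def)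

lemma override_opt_inside:
  "override_opt v (\<lambda>x. if x \<in> V then Some (c x) else None) = override_on v c V"
  by (auto simp: fun_eq_iff override_opt_def override_on_def)

lemma assignment_override_on:
  "assignment N u \<Longrightarrow> assignment N v \<Longrightarrow> assignment N (override_on v u V)"
  by (auto simp: assignment_def override_on_def)

lemma sat_meet_fm:
  assumes v: "assignment M v"
  shows "sat (struct_params M) v (meet_fm V \<psi> c d) \<longleftrightarrow> (\<forall>u. assignment M u \<longrightarrow>
    sat M (override_on v u V) \<psi> \<longrightarrow> sat M (override_on c u V) \<psi> \<longrightarrow> sat M (override_on d u V) \<psi>)"
proof -
  have "sat (struct_params M) v (meet_fm V \<psi> c d) \<longleftrightarrow> \<not> (\<exists>w. assignment M w \<and>
      (\<forall>x. x \<notin> fv \<psi> \<inter> V \<longrightarrow> w x = v x) \<and> (sat M w \<psi> \<and> sat M (override_on c w V) \<psi>) \<and>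
      \<not> sat M (override_on d w V) \<psi>)"
    using v by (simp add: meet_fm_def sat_exs sat_inst sat_map_Inl override_opt_outside)
  also have "\<dots> \<longleftrightarrow> \<not> (\<exists>u. assignment M u \<and> sat M (override_on v u V) \<psi> \<and>
      sat M (override_on c u V) \<psi> \<and> \<not> sat M (override_on d u V) \<psi>)" (is "\<not> ?l \<longleftrightarrow> \<not> ?r")
  proof (rule arg_cong[where f = Not], rule iffI)
    assume ?l
    then obtain w where w: "assignment M w" "\<And>x. x \<notin> fv \<psi> \<inter> V \<Longrightarrow> w x = v x" "sat M w \<psi>"
      "sat M (override_on c w V) \<psi>" "\<not> sat M (override_on d w V) \<psi>" by blast
    have "sat M (override_on v w V) \<psi> \<longleftrightarrow> sat M w \<psi>"
      by (rule sat_cong) (use w(2) in \<open>auto simp: override_on_def\<close>)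
    with w show ?r by blast
  next
    assume ?r
    then obtain u where u: "assignment M u" "sat M (override_on v u V) \<psi>"
      "sat M (override_on c u V) \<psi>" "\<not> sat M (override_on d u V) \<psi>" by blast
    \<comment> \<open>Only the variables in \<open>fv \<psi> \<inter> V\<close> are quantified in
      \<open>meet_fm\<close>; the other values of \<open>u\<close> do not affect the three instances
      of \<psi>.\<close>
    let ?w = "override_on v u (fv \<psi> \<inter> V)"
    have "sat M ?w \<psi> \<longleftrightarrow> sat M (override_on v u V) \<psi>"
      by (rule sat_cong) (auto simp: override_on_def)
    moreover have "sat M (override_on b ?w V) \<psi> \<longleftrightarrow> sat M (override_on b u V) \<psi>" for b
      by (rule sat_cong) (auto simp: override_on_def)
    moreover have "assignment M ?w" using u(1) v by (rule assignment_override_on)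
    ultimately show ?l using u by (intro exI[of _ ?w]) (auto simp: override_on_def)
  qed
  finally show ?thesis by blast
qed

lemma fv_meet_fm: "fv (meet_fm V \<psi> c d) \<subseteq> fv \<psi> - V"
  by (auto simp: meet_fm_def fv_inst)

lemma wf_meet_fm:
  assumes "wf_fm L \<psi>" "range c \<subseteq> X" "range d \<subseteq> X"
  shows "wf_fm (lang_params L X) (meet_fm V \<psi> c d)"
proof -
  have "wf_fm (lang_params L X) (inst (map_fm Inl id \<psi>) (\<lambda>x. if x \<in> V then None else Some (b x)))"
    if "range b \<subseteq> X" for b
    by (rule wf_inst[where X = X]) (use that assms(1) in \<open>auto simp: wf_map_Inl split: if_splits\<close>)
  then show ?thesis using assms by (simp add: meet_fm_def wf_map_Inl)
qed

context fin_product
begin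

lemma cls_override_on:
  "(\<lambda>x. cls (override_on b a V x)) = override_on (\<lambda>x. cls (b x)) (\<lambda>x. cls (a x)) V"
  by (auto simp: fun_eq_iff override_on_def)

lemma proj_override_on: "proj (override_on b a V) n = override_on (proj b n) (proj a n) V"
  by (auto simp: fun_eq_iff override_on_def)

lemma rep_override_on: "rep a \<Longrightarrow> rep b \<Longrightarrow> rep (override_on b a V)"
  by (auto simp: rep_def override_on_def)

definition holds_at :: "nat set \<Rightarrow> ('f, 'r) fm \<Rightarrow> (nat \<Rightarrow> nat \<Rightarrow> 'a) \<Rightarrow> (nat \<Rightarrow> nat \<Rightarrow> 'a) \<Rightarrow> nat \<Rightarrow> bool" where
  "holds_at V \<psi> a b n \<longleftrightarrow> sat (Ms n) (override_on (proj b n) (proj a n) V) \<psi>"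

lemma horn_sat_override:
  assumes "horn \<psi>" "rep a" "rep b"
  shows "sat M (override_on (\<lambda>x. cls (b x)) (\<lambda>x. cls (a x)) V) \<psi> \<longleftrightarrow> (\<forall>\<^sub>\<infinity>n. holds_at V \<psi> a b n)"
  using horn_sat[OF assms(1) rep_override_on[OF assms(2,3)], of V]
  unfolding cls_override_on proj_override_on holds_at_def .

text \<open>Colour \<open>i < j\<close> by the members of \<open>H\<close> true of
  \<open>(a i, b j)\<close> and those true of \<open>(a j, b i)\<close>. On four homogeneous points
  these are constant sets \<open>T\<close> and \<open>U\<close>, which differ as \<open>H\<close>
  determines \<phi>. Any formula in just one of them serves as \<psi>. With four distinct indices
  the uncontrolled diagonal pairs never occur.\<close>

lemma unstable_pattern:
  assumes "\<not> stable TYPE('m) L (complete_theory L M)"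
  obtains \<psi> V a0 a1 b0 b1 where "horn \<psi>" "rep a0" "rep a1" "rep b0" "rep b1"
    "\<forall>\<^sub>\<infinity>n. holds_at V \<psi> a0 b0 n" "\<forall>\<^sub>\<infinity>n. holds_at V \<psi> a0 b1 n" "\<forall>\<^sub>\<infinity>n. holds_at V \<psi> a1 b1 n"
    "\<not> (\<forall>\<^sub>\<infinity>n. holds_at V \<psi> a1 b0 n)"
proof -
  obtain \<phi> V where \<phi>: "wf_fm L \<phi>" "has_order_property TYPE('m) L (complete_theory L M) \<phi> V"
    using assms unfolding stable_def by blast
  obtain H where H: "finite H" "\<forall>h \<in> H. horn h" "determines H \<phi>"
    using determined_by_horn[OF \<phi>(1)] by blast
  have "finite (Pow H \<times> Pow H)" using H(1) by simp
  from ramsey_pairs[OF this] obtain N :: nat where N: "\<forall>c. (\<forall>i j. c i j \<in> Pow H \<times> Pow H) \<longrightarrow>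
    (\<exists>i0 i1 i2 i3 k. i0 < i1 \<and> i1 < i2 \<and> i2 < i3 \<and> i3 < N \<and>
    (\<forall>i \<in> {i0, i1, i2, i3}. \<forall>j \<in> {i0, i1, i2, i3}. i < j \<longrightarrow> c i j = k))" ..
  have "is_structure L M" by (rule is_structure_reduced_product[OF is_ideal_Fin structures])
  from order_property_transfer[OF this \<phi>, of N] obtain a b where
    *: "(\<forall>i. assignment M (a i)) \<and> (\<forall>j. assignment M (b j)) \<and>
      (\<forall>i<N. \<forall>j<N. sat M (override_on (b j) (a i) V) \<phi> \<longleftrightarrow> i \<le> j)"
    by (elim exE)
  then have a: "\<And>i. assignment M (a i)" and b: "\<And>j. assignment M (b j)"
    and ab: "\<And>i j. i < N \<Longrightarrow> j < N \<Longrightarrow> sat M (override_on (b j) (a i) V) \<phi> \<longleftrightarrow> i \<le> j"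
    by simp_all
  define t where "t i j = {h \<in> H. sat M (override_on (b j) (a i) V) h}" for i j
  have "\<forall>i j. (t i j, t j i) \<in> Pow H \<times> Pow H" by (auto simp: t_def)
  from N[THEN spec, of "\<lambda>i j. (t i j, t j i)", THEN mp, OF this] obtain i0 i1 i2 i3 k where
    **: "i0 < i1 \<and> i1 < i2 \<and> i2 < i3 \<and> i3 < N \<and>
      (\<forall>i \<in> {i0, i1, i2, i3}. \<forall>j \<in> {i0, i1, i2, i3}. i < j \<longrightarrow> (t i j, t j i) = k)"
    by (elim exE)
  then have i: "i0 < i1" "i1 < i2" "i2 < i3" "i3 < N" by simp_all
  obtain T U where k: "k = (T, U)" by fastforce
  have hom: "t i j = T" "t j i = U"
    if "i \<in> {i0, i1, i2, i3}" "j \<in> {i0, i1, i2, i3}" "i < j" for i j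
    using ** that unfolding k by blast+
  have "T \<noteq> U"
  proof
    assume "T = U"
    then have "t i0 i1 = t i1 i0" using hom[of i0 i1] i by auto
    then have "sat M (override_on (b i1) (a i0) V) h \<longleftrightarrow> sat M (override_on (b i0) (a i1) V) h"
      if "h \<in> H" for h using that by (auto simp: t_def)
    then have "sat M (override_on (b i1) (a i0) V) \<phi> \<longleftrightarrow> sat M (override_on (b i0) (a i1) V) \<phi>"
      by (rule determinesD[OF H(3) assignment_override_on[OF a b] assignment_override_on[OF a b]])
    then show False using ab[of i0 i1] ab[of i1 i0] i by auto
  qed
  have vals: "t i0 i1 = T" "t i0 i3 = T" "t i2 i3 = T" "t i1 i2 = T"
    "t i2 i1 = U" "t i3 i2 = U" "t i3 i0 = U" "t i1 i0 = U"
    using i by (simp_all add: hom)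
  have TU: "T \<subseteq> H" "U \<subseteq> H" using vals(1,5) by (auto simp: t_def)
  \<comment> \<open>The indices \<open>p, q, r, s\<close> go upwards if \<psi> lies in
    \<open>T\<close> only and downwards if it lies in \<open>U\<close> only; in both cases
    \<open>(r, q)\<close> alone is ordered the opposite way.\<close>
  have "\<exists>p q r s \<psi>. \<psi> \<in> H \<and> \<psi> \<in> t p q \<and> \<psi> \<in> t p s \<and> \<psi> \<in> t r s \<and> \<psi> \<notin> t r q"
  proof (cases "T \<subseteq> U")
    case False
    then obtain \<psi> where "\<psi> \<in> T" "\<psi> \<notin> U" by blast
    then show ?thesis using TU
      by (intro exI[of _ i0] exI[of _ i1] exI[of _ i2] exI[of _ i3] exI[of _ \<psi>]) (auto simp: vals)
  next
    case True
    then obtain \<psi> where "\<psi> \<in> U" "\<psi> \<notin> T" using \<open>T \<noteq> U\<close> by blast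
    then show ?thesis using TU
      by (intro exI[of _ i3] exI[of _ i2] exI[of _ i1] exI[of _ i0] exI[of _ \<psi>]) (auto simp: vals)
  qed
  then obtain p q r s \<psi> where \<psi>: "\<psi> \<in> H \<and> \<psi> \<in> t p q \<and> \<psi> \<in> t p s \<and> \<psi> \<in> t r s \<and> \<psi> \<notin> t r q"
    by (elim exE)
  obtain a0 where a0: "rep a0" "a p = (\<lambda>x. cls (a0 x))" using assignment_rep[OF a] .
  obtain a1 where a1: "rep a1" "a r = (\<lambda>x. cls (a1 x))" using assignment_rep[OF a] .
  obtain b0 where b0: "rep b0" "b q = (\<lambda>x. cls (b0 x))" using assignment_rep[OF b] .
  obtain b1 where b1: "rep b1" "b s = (\<lambda>x. cls (b1 x))" using assignment_rep[OF b] .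
  have horn: "horn \<psi>" using \<psi> H(2) by blast
  have t: "\<psi> \<in> t i j \<longleftrightarrow> sat M (override_on (b j) (a i) V) \<psi>" for i j
    using \<psi> by (simp add: t_def)
  show thesis
  proof (rule that[OF horn a0(1) a1(1) b0(1) b1(1)])
    show "\<forall>\<^sub>\<infinity>n. holds_at V \<psi> a0 b0 n" "\<forall>\<^sub>\<infinity>n. holds_at V \<psi> a0 b1 n" "\<forall>\<^sub>\<infinity>n. holds_at V \<psi> a1 b1 n"
      "\<not> (\<forall>\<^sub>\<infinity>n. holds_at V \<psi> a1 b0 n)"
      using \<psi> unfolding t a0(2) a1(2) b0(2) b1(2)
        horn_sat_override[OF horn a0(1) b0(1)] horn_sat_override[OF horn a0(1) b1(1)]
        horn_sat_override[OF horn a1(1) b1(1)] horn_sat_override[OF horn a1(1) b0(1)] by blast+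
  qed
qed

end

lemma aleph_1_less_continuum:
  assumes "\<not> continuum_hypothesis"
  shows "aleph_1 <o |UNIV :: nat set set|"
proof -
  have "natLeq <o |UNIV :: nat set set|"
    using card_of_Pow[of "UNIV :: nat set"] ordIso_ordLess_trans[OF ordIso_symmetric[OF card_of_nat]]
    by simp
  then have "aleph_1 \<le>o |UNIV :: nat set set|"
    unfolding aleph_1_def by (intro cardSuc_least natLeq_Card_order card_of_Card_order)
  then show ?thesis
    using assms ordIso_symmetric
    by (auto simp: continuum_hypothesis_def ordLeq_iff_ordLess_or_ordIso)
qed

context fin_product
begin

text \<open>For each set \<open>X\<close> of natural numbers mix \<open>p\<close> and
  \<open>q\<close> along \<open>D X\<close>, which repeats every element of \<open>X\<close>
  infinitely often. Distinct sets then give sequences that differ at infinitely many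
  coordinates.\<close>

lemma continuum_le_universe:
  assumes p: "p \<in> product_set Ms" and q: "q \<in> product_set Ms" and neq: "\<exists>\<^sub>\<infinity>n. p n \<noteq> q n"
  shows "|UNIV :: nat set set| \<le>o |universe M|"
proof -
  define e where "e = enumerate {n. p n \<noteq> q n}"
  have inf: "infinite {n. p n \<noteq> q n}" using neq by (simp add: frequently_cofinite)
  have e: "inj e" "\<And>m. p (e m) \<noteq> q (e m)"
    using inj_enumerate[OF inf] enumerate_in_set[OF inf] by (auto simp: e_def)
  define D :: "nat set \<Rightarrow> nat set" where "D X = {m. fst (prod_decode m) \<in> X}" for X
  define c where "c X n = (if n \<in> e ` D X then p n else q n)" for X n
  have c: "c X \<in> product_set Ms" for X using p q by (auto simp: c_def product_set_def)
  have c_e: "c X (e m) = (if m \<in> D X then p (e m) else q (e m))" for X m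
    using e(1) by (auto simp: c_def inj_image_mem_iff)
  have "inj (\<lambda>X. cls (c X))"
  proof (rule injI, rule ccontr)
    fix X Y assume eq: "cls (c X) = cls (c Y)" and "X \<noteq> Y"
    then obtain k where k: "k \<in> X \<longleftrightarrow> k \<notin> Y" by blast
    have "c X (e (prod_encode (k, i))) \<noteq> c Y (e (prod_encode (k, i)))" for i
      using k e(2)[of "prod_encode (k, i)"] by (auto simp: c_e D_def)
    then have "range (\<lambda>i. e (prod_encode (k, i))) \<subseteq> {n. c X n \<noteq> c Y n}" by auto
    moreover have "inj (\<lambda>i. e (prod_encode (k, i)))" using e(1) by (intro injI) (simp add: inj_eq)
    ultimately have "infinite {n. c X n \<noteq> c Y n}" by (meson finite_subset range_inj_infinite)
    then show False using eq by (simp add: cls_eq_iff[OF c c] eventually_cofinite)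
  qed
  then show ?thesis
    unfolding card_of_ordLeq[symmetric] using c by (auto simp: universe_M)
qed

text \<open>Stated for any \<kappa> above \<open>aleph_1\<close>, this serves both for
  \<open>aleph_2\<close> and for the cardinality of \<open>M\<close>.\<close>

lemma not_kappa_saturated:
  assumes \<psi>: "horn \<psi>" and rep: "rep a0" "rep a1" "rep b0" "rep b1"
    and pos: "\<forall>\<^sub>\<infinity>n. holds_at V \<psi> a0 b0 n" "\<forall>\<^sub>\<infinity>n. holds_at V \<psi> a0 b1 n" "\<forall>\<^sub>\<infinity>n. holds_at V \<psi> a1 b1 n"
    and neg: "\<not> (\<forall>\<^sub>\<infinity>n. holds_at V \<psi> a1 b0 n)"
    and \<kappa>: "aleph_1 <o \<kappa>"
  shows "\<not> kappa_saturated \<kappa> L M"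
proof
  assume sat: "kappa_saturated \<kappa> L M"
  obtain \<F> \<H> :: "nat set set" where card: "|\<F>| \<le>o aleph_1" "|\<H>| \<le>o aleph_1"
    and fin: "\<And>F H. F \<in> \<F> \<Longrightarrow> H \<in> \<H> \<Longrightarrow> finite (F \<inter> H)"
    and insep: "\<not> (\<exists>C. (\<forall>F \<in> \<F>. finite (F - C)) \<and> (\<forall>H \<in> \<H>. finite (H \<inter> C)))"
    using inseparable_families by (elim exE conjE) blast
  \<comment> \<open>\<open>e\<close> carries sets of natural numbers to the coordinates where
    \<open>\<psi>(a1, b0)\<close> fails.\<close>
  define e where "e = enumerate {n. \<not> holds_at V \<psi> a1 b0 n}"
  have inf: "infinite {n. \<not> holds_at V \<psi> a1 b0 n}" using neg by (simp add: eventually_cofinite)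
  have e: "inj e" "\<And>m. \<not> holds_at V \<psi> a1 b0 (e m)"
    using inj_enumerate[OF inf] enumerate_in_set[OF inf] by (auto simp: e_def)
  define a where "a X x n = (if n \<in> e ` X then a1 x n else a0 x n)" for X x n
  define b where "b X x n = (if n \<in> e ` X then b1 x n else b0 x n)" for X x n
  have a: "rep (a X)" and b: "rep (b X)" for X
    using rep by (auto simp: rep_def a_def b_def product_set_def)
  have proj_a: "proj (a X) n = (if n \<in> e ` X then proj a1 n else proj a0 n)"
    and proj_b: "proj (b X) n = (if n \<in> e ` X then proj b1 n else proj b0 n)" for X n
    by (auto simp: a_def b_def)
  have a_empty: "a {} = a0" and b_empty: "b {} = b0" by (simp_all add: a_def b_def fun_eq_iff)
  \<comment> \<open>Only the combination of \<open>a1\<close> with \<open>b0\<close> is bad, and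
    \<open>X \<subseteq> Y\<close> excludes it at every coordinate.\<close>
  have mono: "\<forall>\<^sub>\<infinity>n. holds_at V \<psi> (a X) (b Y) n" if "X \<subseteq> Y" for X Y
    using pos
  proof eventually_elim
    case (elim n)
    have "n \<in> e ` X \<Longrightarrow> n \<in> e ` Y" using that by auto
    then show ?case using elim unfolding holds_at_def proj_a proj_b by auto
  qed

  define \<phi> where "\<phi> F = inst (map_fm Inl id \<psi>) (\<lambda>x. if x \<in> V then Some (cls (a F x)) else None)" for F
  define \<theta> where "\<theta> H = meet_fm V \<psi> (\<lambda>x. cls (b H x)) (\<lambda>x. cls (b0 x))" for H
  have sat_\<phi>: "sat (struct_params M) (\<lambda>x. cls (y x)) (\<phi> F) \<longleftrightarrow> (\<forall>\<^sub>\<infinity>n. holds_at V \<psi> (a F) y n)"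
    if "rep y" for y F
    unfolding \<phi>_def sat_inst sat_map_Inl override_opt_inside by (rule horn_sat_override[OF \<psi> a that])
  have sat_\<theta>: "sat (struct_params M) (\<lambda>x. cls (y x)) (\<theta> H) \<longleftrightarrow> (\<forall>x. rep x \<longrightarrow>
      (\<forall>\<^sub>\<infinity>n. holds_at V \<psi> x y n) \<longrightarrow> (\<forall>\<^sub>\<infinity>n. holds_at V \<psi> x (b H) n) \<longrightarrow> (\<forall>\<^sub>\<infinity>n. holds_at V \<psi> x b0 n))"
    if y: "rep y" for y H
    unfolding \<theta>_def sat_meet_fm[OF assignment_cls[OF y]]
  proof (intro iffI allI impI)
    fix x assume *: "\<forall>u. assignment M u \<longrightarrow> sat M (override_on (\<lambda>x. cls (y x)) u V) \<psi> \<longrightarrow>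
        sat M (override_on (\<lambda>x. cls (b H x)) u V) \<psi> \<longrightarrow> sat M (override_on (\<lambda>x. cls (b0 x)) u V) \<psi>"
      and x: "rep x" "\<forall>\<^sub>\<infinity>n. holds_at V \<psi> x y n" "\<forall>\<^sub>\<infinity>n. holds_at V \<psi> x (b H) n"
    show "\<forall>\<^sub>\<infinity>n. holds_at V \<psi> x b0 n"
      using *[THEN spec, THEN mp, OF assignment_cls[OF x(1)]] x(2,3)
      unfolding horn_sat_override[OF \<psi> x(1) y] horn_sat_override[OF \<psi> x(1) b]
        horn_sat_override[OF \<psi> x(1) rep(3)] by blast
  next
    fix u assume *: "\<forall>x. rep x \<longrightarrow> (\<forall>\<^sub>\<infinity>n. holds_at V \<psi> x y n) \<longrightarrow>
        (\<forall>\<^sub>\<infinity>n. holds_at V \<psi> x (b H) n) \<longrightarrow> (\<forall>\<^sub>\<infinity>n. holds_at V \<psi> x b0 n)"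
      and u: "assignment M u" and s: "sat M (override_on (\<lambda>x. cls (y x)) u V) \<psi>"
        "sat M (override_on (\<lambda>x. cls (b H x)) u V) \<psi>"
    obtain x where x: "rep x" "u = (\<lambda>i. cls (x i))" using assignment_rep[OF u] .
    show "sat M (override_on (\<lambda>x. cls (b0 x)) u V) \<psi>"
      using *[THEN spec, THEN mp, OF x(1)] s
      unfolding x(2) horn_sat_override[OF \<psi> x(1) y] horn_sat_override[OF \<psi> x(1) b]
        horn_sat_override[OF \<psi> x(1) rep(3)] by blast
  qed

  \<comment> \<open>The index \<open>{}\<close> contributes the entries of \<open>a0\<close> and
    \<open>b0\<close>.\<close>
  define X where "X = (\<Union>F \<in> insert {} \<F>. range (\<lambda>x. cls (a F x))) \<union>
    (\<Union>H \<in> insert {} \<H>. range (\<lambda>x. cls (b H x)))"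
  \<comment> \<open>The member \<open>\<phi> {}\<close> is the condition
    \<open>\<psi>(a0, y)\<close>, needed for coordinates outside the image of
    \<open>H \<inter> C\<close> below.\<close>
  define \<Gamma> where "\<Gamma> = \<phi> ` insert {} \<F> \<union> \<theta> ` \<H>"
  define B where "B = Field aleph_1"
  have B: "infinite B" using uncountable_Field_aleph_1 countable_finite by (auto simp: B_def)
  have B_iso: "|B| =o aleph_1" unfolding B_def by (rule card_of_Field_ordIso[OF Card_order_aleph_1])
  have B_less: "|B| <o \<kappa>" using B_iso \<kappa> by (rule ordIso_ordLess_trans)
  have card_UN: "|\<Union>F \<in> insert {} \<A>. range (g F)| \<le>o |B|" if "|\<A>| \<le>o aleph_1"
    for \<A> :: "nat set set" and g :: "nat set \<Rightarrow> nat \<Rightarrow> (nat \<Rightarrow> 'a) set"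
  proof (rule card_of_UNION_ordLeq_infinite[OF B])
    have "|\<A>| \<le>o |B|" using that B_iso ordIso_symmetric ordLeq_ordIso_trans by blast
    moreover have "|{{} :: nat set}| \<le>o |B|" using B by (intro card_of_singl_ordLeq) auto
    ultimately show "|insert {} \<A>| \<le>o |B|"
      using B card_of_Un_ordLeq_infinite_Field[of "|B|" "{{}}" \<A>] card_of_Card_order[of B]
      by (simp add: Field_card_of)
    have "|range (g F)| \<le>o |B|" for F
      using card_of_image[of "g F" UNIV] B infinite_iff_card_of_nat ordLeq_transitive by blast
    then show "\<forall>F \<in> insert {} \<A>. |range (g F)| \<le>o |B|" by blast
  qed
  have X: "|X| \<le>o |B|"
    unfolding X_def
    by (rule card_of_Un_ordLeq_infinite_Field[OF _ card_UN[OF card(1)] card_UN[OF card(2)]])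
      (use B card_of_Card_order[of B] in \<open>simp_all add: Field_card_of\<close>)
  have XM: "X \<subseteq> universe M"
    using a b by (auto simp: X_def universe_M rep_def)
  have wf: "wf_fm (lang_params L X) \<gamma> \<and> fv \<gamma> \<subseteq> fv \<psi> - V" if "\<gamma> \<in> \<Gamma>" for \<gamma>
    using that unfolding \<Gamma>_def
  proof (elim UnE imageE)
    fix F assume F: "F \<in> insert {} \<F>" "\<gamma> = \<phi> F"
    have "cls (a F x) \<in> X" for x using F(1) unfolding X_def by blast
    then have "wf_fm (lang_params L X) \<gamma>"
      unfolding F(2) \<phi>_def using horn_wf[OF \<psi>]
      by (intro wf_inst[where X = X]) (auto simp: wf_map_Inl split: if_splits)
    moreover have "fv \<gamma> \<subseteq> fv \<psi> - V" unfolding F(2) \<phi>_def fv_inst by auto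
    ultimately show ?thesis ..
  next
    fix H assume H: "H \<in> \<H>" "\<gamma> = \<theta> H"
    have "range (\<lambda>x. cls (b H x)) \<subseteq> X" "range (\<lambda>x. cls (b0 x)) \<subseteq> X"
      using H(1) b_empty by (auto simp: X_def)
    then show ?thesis unfolding H(2) \<theta>_def by (intro conjI wf_meet_fm horn_wf \<psi> fv_meet_fm)
  qed
  have fin_sat: "\<exists>w. assignment M w \<and> (\<forall>\<gamma> \<in> q. sat (struct_params M) w \<gamma>)"
    if q: "finite q" "q \<subseteq> \<Gamma>" for q
  proof -
    have "finite (q \<inter> \<phi> ` insert {} \<F>)" "q \<inter> \<phi> ` insert {} \<F> \<subseteq> \<phi> ` insert {} \<F>" using q(1) by auto
    from finite_subset_image[OF this] obtain \<F>0 where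
      \<F>0: "\<F>0 \<subseteq> insert {} \<F>" "finite \<F>0" "q \<inter> \<phi> ` insert {} \<F> = \<phi> ` \<F>0" by blast
    define Y where "Y = \<Union> \<F>0"
    have "sat (struct_params M) (\<lambda>x. cls (b Y x)) \<gamma>" if \<gamma>: "\<gamma> \<in> q" for \<gamma>
    proof (cases "\<gamma> \<in> \<phi> ` insert {} \<F>")
      case True
      with \<gamma> have "\<gamma> \<in> \<phi> ` \<F>0" unfolding \<F>0(3)[symmetric] by (rule IntI)
      then obtain F where F: "F \<in> \<F>0" "\<gamma> = \<phi> F" by blast
      then show ?thesis using mono[of F Y] by (auto simp: sat_\<phi>[OF b] Y_def)
    next
      case False
      then obtain H where H: "H \<in> \<H>" "\<gamma> = \<theta> H" using \<gamma> q(2) unfolding \<Gamma>_def by blast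
      have "finite (F \<inter> H)" if "F \<in> \<F>0" for F using that \<F>0(1) fin[OF _ H(1)] by auto
      then have "finite (\<Union>F \<in> \<F>0. F \<inter> H)" using \<F>0(2) by blast
      moreover have "Y \<inter> H = (\<Union>F \<in> \<F>0. F \<inter> H)" by (auto simp: Y_def)
      ultimately have "finite (e ` (Y \<inter> H))" by simp
      then have small: "\<forall>\<^sub>\<infinity>n. n \<notin> e ` (Y \<inter> H)" by (simp add: eventually_cofinite)
      show ?thesis
        unfolding H(2) sat_\<theta>[OF b]
      proof (intro allI impI)
        fix x assume "\<forall>\<^sub>\<infinity>n. holds_at V \<psi> x (b Y) n" "\<forall>\<^sub>\<infinity>n. holds_at V \<psi> x (b H) n"
        with small show "\<forall>\<^sub>\<infinity>n. holds_at V \<psi> x b0 n"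
        \<comment> \<open>Off the finite image of \<open>Y \<inter> H\<close>, one of
          \<open>b Y\<close> and \<open>b H\<close> coincides with \<open>b0\<close>, so one of the
          two assumptions is already the conclusion.\<close>
        proof eventually_elim
          case (elim n)
          then have "n \<notin> e ` Y \<or> n \<notin> e ` H" using e(1) by (simp add: image_Int)
          then show ?case using elim(2,3) unfolding holds_at_def proj_b by auto
        qed
      qed
    qed
    then show ?thesis using assignment_cls[OF b] by blast
  qed
  have "finite (fv \<psi> - V)" by simp
  from kappa_saturated_tuple[OF sat B B_less this XM X wf fin_sat]
  obtain w where w: "assignment M w" "\<And>\<gamma>. \<gamma> \<in> \<Gamma> \<Longrightarrow> sat (struct_params M) w \<gamma>" by blast
  obtain y where y: "rep y" "w = (\<lambda>x. cls (y x))" using assignment_rep[OF w(1)] .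
  \<comment> \<open>The candidate for a separating set, pulled back along \<open>e\<close>.\<close>
  define C where "C = {m. holds_at V \<psi> a1 y (e m)}"
  have real_\<phi>: "\<forall>\<^sub>\<infinity>n. holds_at V \<psi> (a F) y n" if "F \<in> insert {} \<F>" for F
    using w(2)[of "\<phi> F"] that unfolding y(2) sat_\<phi>[OF y(1)] by (auto simp: \<Gamma>_def)
  have "finite (F - C)" if F: "F \<in> \<F>" for F
  proof -
    have "\<not> holds_at V \<psi> (a F) y (e m)" if "m \<in> F - C" for m
      using that unfolding C_def holds_at_def proj_a by auto
    then have "e ` (F - C) \<subseteq> {n. \<not> holds_at V \<psi> (a F) y n}" by auto
    then have "finite (e ` (F - C))"
      using real_\<phi>[of F] F finite_subset unfolding eventually_cofinite by blast
    then show ?thesis using e(1) by (meson finite_imageD inj_on_subset subset_UNIV)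
  qed
  \<comment> \<open>By the choice of \<open>C\<close> and \<open>\<psi>(a0, y)\<close>, the tuple
    \<open>a (H \<inter> C)\<close> stands in \<psi> to \<open>y\<close>, and by \<open>mono\<close>
    to \<open>b H\<close>. Then \<open>\<theta> H\<close> puts it in \<psi> to \<open>b0\<close>,
    which fails at \<open>e m\<close> for every \<open>m\<close> in
    \<open>H \<inter> C\<close>.\<close>
  moreover have "finite (H \<inter> C)" if H: "H \<in> \<H>" for H
  proof -
    have "\<forall>\<^sub>\<infinity>n. holds_at V \<psi> a0 y n" using real_\<phi>[of "{}"] by (simp add: a_empty)
    then have "\<forall>\<^sub>\<infinity>n. holds_at V \<psi> (a (H \<inter> C)) y n"
    proof eventually_elim
      case (elim n)
      then show ?case unfolding holds_at_def proj_a by (auto simp: C_def holds_at_def)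
    qed
    moreover have "\<forall>\<^sub>\<infinity>n. holds_at V \<psi> (a (H \<inter> C)) (b H) n" by (rule mono) simp
    moreover have "sat (struct_params M) w (\<theta> H)" using w(2) H by (simp add: \<Gamma>_def)
    ultimately have "\<forall>\<^sub>\<infinity>n. holds_at V \<psi> (a (H \<inter> C)) b0 n"
      using a unfolding y(2) sat_\<theta>[OF y(1)] by blast
    moreover have "\<not> holds_at V \<psi> (a (H \<inter> C)) b0 (e m)" if "m \<in> H \<inter> C" for m
      using e(2)[of m] that unfolding holds_at_def proj_a by auto
    then have "e ` (H \<inter> C) \<subseteq> {n. \<not> holds_at V \<psi> (a (H \<inter> C)) b0 n}" by auto
    ultimately have "finite (e ` (H \<inter> C))"
      using finite_subset unfolding eventually_cofinite by blast
    then show ?thesis using e(1) by (meson finite_imageD inj_on_subset subset_UNIV)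
  qed
  ultimately show False using insep by blast
qed

text \<open>The truth of \<psi> changes between \<open>a0\<close> and \<open>a1\<close> at
  infinitely many coordinates. As \<psi> has finitely many free variables, a single entry of the two
  tuples differs infinitely often.\<close>

lemma continuum_le_universe_of_pattern:
  assumes rep: "rep a0" "rep a1"
    and pos: "\<forall>\<^sub>\<infinity>n. holds_at V \<psi> a0 b0 n" and neg: "\<not> (\<forall>\<^sub>\<infinity>n. holds_at V \<psi> a1 b0 n)"
  shows "|UNIV :: nat set set| \<le>o |universe M|"
proof -
  have "\<exists>\<^sub>\<infinity>n. \<not> holds_at V \<psi> a1 b0 n \<and> holds_at V \<psi> a0 b0 n"
    using neg pos by (intro INFM_conjI) (simp_all add: not_eventually)
  then have "\<exists>\<^sub>\<infinity>n. \<exists>x \<in> fv \<psi>. a0 x n \<noteq> a1 x n"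
  proof (rule frequently_elim1)
    fix n assume n: "\<not> holds_at V \<psi> a1 b0 n \<and> holds_at V \<psi> a0 b0 n"
    show "\<exists>x \<in> fv \<psi>. a0 x n \<noteq> a1 x n"
    proof (rule ccontr)
      assume *: "\<not> (\<exists>x \<in> fv \<psi>. a0 x n \<noteq> a1 x n)"
      have "holds_at V \<psi> a1 b0 n \<longleftrightarrow> holds_at V \<psi> a0 b0 n"
        unfolding holds_at_def by (rule sat_cong) (use * in \<open>auto simp: override_on_def\<close>)
      with n show False by blast
    qed
  qed
  then obtain x where "\<exists>\<^sub>\<infinity>n. a0 x n \<noteq> a1 x n"
    unfolding frequently_bex_finite_distrib[OF finite_fv] by blast
  then show ?thesis using rep by (intro continuum_le_universe) (auto simp: rep_def)
qed

end

theorem theorem2: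
  fixes L :: "('f, 'r) language"
    and Ms :: "nat \<Rightarrow> ('a, 'f, 'r) struct"
    and M :: "((nat \<Rightarrow> 'a) set, 'f, 'r) struct"
  assumes "countable_language L"
    and "\<And>n. is_structure L (Ms n)"
    and "M = reduced_product Fin Ms"
    and "\<not> stable TYPE('m) L (complete_theory L M)"
  shows "\<not> kappa_saturated aleph_2 L M \<and> (\<not> continuum_hypothesis \<longrightarrow> \<not> saturated L M)"
proof -
  interpret fin_product L Ms by unfold_locales (rule assms(2))
  obtain \<psi> V a0 a1 b0 b1 where pat: "horn \<psi>" "rep a0" "rep a1" "rep b0" "rep b1"
    "\<forall>\<^sub>\<infinity>n. holds_at V \<psi> a0 b0 n" "\<forall>\<^sub>\<infinity>n. holds_at V \<psi> a0 b1 n" "\<forall>\<^sub>\<infinity>n. holds_at V \<psi> a1 b1 n"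
    "\<not> (\<forall>\<^sub>\<infinity>n. holds_at V \<psi> a1 b0 n)"
    using unstable_pattern[OF assms(4)[unfolded assms(3)]] .
  have "aleph_1 <o aleph_2"
    unfolding aleph_2_def by (rule cardSuc_greater[OF Card_order_aleph_1])
  from not_kappa_saturated[OF pat this] have "\<not> kappa_saturated aleph_2 L M"
    unfolding assms(3) .
  moreover have "\<not> saturated L M" if "\<not> continuum_hypothesis"
  proof -
    \<comment> \<open>Here \<kappa> is the size of \<open>M\<close> itself, which is at least the
      continuum.\<close>
    have "aleph_1 <o |universe (reduced_product Fin Ms)|"
      using aleph_1_less_continuum[OF that] continuum_le_universe_of_pattern[OF pat(2,3,6,9)]
      by (rule ordLess_ordLeq_trans)
    from not_kappa_saturated[OF pat this] show ?thesis unfolding saturated_def assms(3) .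
  qed
  ultimately show ?thesis by blast
qed

end
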